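(* Let $n\geq 1$. Then $\operatorname{depth}(S_{n,3}/I(\mathcal{P}_{n,3}))=\operatorname{sdepth}(S_{n,3}/I(\mathcal{P}_{n,3}))=\left\lceil\frac{n}{3}\right\rceil$.
   Context: $K$ is a field. For a finite simple graph $G$ whose vertices are the variables of a polynomial ring over $K$, the edge ideal $I(G)$ is the squarefree monomial ideal generated by all products $uv$ with $\{u,v\}\in E(G)$. $P_n$ is the path on $n$ vertices ($P_1$ is a single vertex with no edges). The strong product $G_1\boxtimes G_2$ has vertex set $V(G_1)\times V(G_2)$, and two distinct vertices $(v_1,u_1),(v_2,u_2)$ are adjacent iff each coordinate pair is equal or adjacent ($v_1=v_2$ or $v_1v_2\in E(G_1)$, and $u_1=u_2$ or $u_1u_2\in E(G_2)$). Put $\mathcal{P}_{n,m}:=P_n\boxtimes P_m$, with vertices labelled by variables $x_{ij}$ ($1\le i\le n$, $1\le j\le m$), so that distinct $x_{ij},x_{kl}$ are adjacent iff $|i-k|\le 1$ and $|j-l|\le 1$. $S_{n,m}:=K[x_{ij}:1\le i\le n,\ 1\le j\le m]$. Depth is taken with respect to the graded maximal ideal generated by all the variables. Stanley depth: let $S=K[x_1,\dots,x_N]$ and $M$ a finitely generated $\mathbb{Z}^N$-graded $S$-module. A Stanley decomposition $\mathcal{D}$ of $M$ is a finite direct sum of $K$-vector spaces $M=\bigoplus_{i=1}^r w_iK[A_i]$ with $w_i\in M$ homogeneous, $A_i\subseteq\{x_1,\dots,x_N\}$, where $w_iK[A_i]$ (the $K$-span of all $w_iu$, $u$ a monomial in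 $K[A_i]$) is a free $K[A_i]$-module. $\operatorname{sdepth}(\mathcal{D})=\min_i|A_i|$ and $\operatorname{sdepth}(M)$ is the maximum of $\operatorname{sdepth}(\mathcal{D})$ over all Stanley decompositions $\mathcal{D}$ of $M$. *)

theory Defs
  imports Complex_Main "HOL-Algebra.QuotRing" "HOL-Algebra.Module" "HOL-Library.Poly_Mapping"
    "HOL-Library.Extended_Nat" "HOL-Library.FuncSet"
begin

section \<open>Finite simple graphs\<close>

record 'v sgraph =
  verts :: "'v set"
  edges :: "'v set set"

definition path_graph :: "nat \<Rightarrow> nat sgraph" where
  "path_graph n = \<lparr>verts = {1..n}, edges = {{i, Suc i} | i. 1 \<le> i \<and> i < n}\<rparr>"

definition strong_product :: "'a sgraph \<Rightarrow> 'b sgraph \<Rightarrow> ('a \<times> 'b) sgraph" where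
  "strong_product G H =
    \<lparr>verts = verts G \<times> verts H,
     edges = {{(v1, u1), (v2, u2)} | v1 u1 v2 u2.
       v1 \<in> verts G \<and> v2 \<in> verts G \<and> u1 \<in> verts H \<and> u2 \<in> verts H \<and>
       (v1, u1) \<noteq> (v2, u2) \<and>
       (v1 = v2 \<or> {v1, v2} \<in> edges G) \<and> (u1 = u2 \<or> {u1, u2} \<in> edges H)}\<rparr>"

definition strong_grid :: "nat \<Rightarrow> nat \<Rightarrow> (nat \<times> nat) sgraph" where
  "strong_grid n m = strong_product (path_graph n) (path_graph m)"

lemma verts_strong_grid: "verts (strong_grid n m) = {1..n} \<times> {1..m}"
  by (simp add: strong_grid_def strong_product_def path_graph_def)

lemma path_edge_iff:
  "{i, k} \<in> edges (path_graph n) \<longleftrightarrow>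
    i \<in> {1..n} \<and> k \<in> {1..n} \<and> (k = Suc i \<or> i = Suc k)"
  by (auto simp: path_graph_def doubleton_eq_iff)

lemma strong_grid_edge_iff:
  "{(i, j), (k, l)} \<in> edges (strong_grid n m) \<longleftrightarrow>
    (i, j) \<in> {1..n} \<times> {1..m} \<and> (k, l) \<in> {1..n} \<times> {1..m} \<and> (i, j) \<noteq> (k, l) \<and>
    \<bar>int i - int k\<bar> \<le> 1 \<and> \<bar>int j - int l\<bar> \<le> 1"
  (is "?L \<longleftrightarrow> ?R")
proof -
  have *: "(a = b \<or> {a, b} \<in> edges (path_graph N)) \<longleftrightarrow> \<bar>int a - int b\<bar> \<le> 1"
    if "a \<in> {1..N}" "b \<in> {1..N}" for a b N
    using that by (auto simp: path_edge_iff)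
  define P where "P v1 u1 v2 u2 \<longleftrightarrow>
      v1 \<in> {1..n} \<and> v2 \<in> {1..n} \<and> u1 \<in> {1..m} \<and> u2 \<in> {1..m} \<and> (v1, u1) \<noteq> (v2, u2) \<and>
      (v1 = v2 \<or> {v1, v2} \<in> edges (path_graph n)) \<and>
      (u1 = u2 \<or> {u1, u2} \<in> edges (path_graph m))" for v1 u1 v2 u2
  have sym: "P v2 u2 v1 u1" if "P v1 u1 v2 u2" for v1 u1 v2 u2
    using that unfolding P_def by (metis insert_commute)
  have "edges (strong_grid n m) = {{(v1, u1), (v2, u2)} | v1 u1 v2 u2. P v1 u1 v2 u2}"
    unfolding strong_grid_def strong_product_def P_def by (simp add: path_graph_def)
  then have "?L \<longleftrightarrow> P i j k l"
    using sym by (fastforce simp: doubleton_eq_iff)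
  then have "?L \<longleftrightarrow> (i, j) \<in> {1..n} \<times> {1..m} \<and> (k, l) \<in> {1..n} \<times> {1..m} \<and> (i, j) \<noteq> (k, l) \<and>
      (i = k \<or> {i, k} \<in> edges (path_graph n)) \<and> (j = l \<or> {j, l} \<in> edges (path_graph m))"
    by (auto simp only: P_def mem_Times_iff fst_conv snd_conv)
  then show ?thesis using *[of i n k] *[of j m l] by auto
qed


section \<open>Polynomial rings\<close>

text \<open>A monomial is an exponent function of finite support, a polynomial a coefficient function of
  finite support on the monomials. The ring of polynomials over the type \<open>'k\<close> in the variables \<open>V\<close>
  is carved out of the ring of polynomials in all variables of type \<open>'v\<close>.\<close>

type_synonym ('v, 'k) mpoly = "('v \<Rightarrow>\<^sub>0 nat) \<Rightarrow>\<^sub>0 'k"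

definition mpoly_ring :: "'v set \<Rightarrow> ('v, 'k::comm_ring_1) mpoly ring" where
  "mpoly_ring V =
    \<lparr>carrier = {p. \<forall>m \<in> Poly_Mapping.keys p. Poly_Mapping.keys m \<subseteq> V},
     mult = (*), one = 1, zero = 0, add = (+)\<rparr>"

definition Var :: "'v \<Rightarrow> ('v, 'k::comm_ring_1) mpoly" where
  "Var v = Poly_Mapping.single (Poly_Mapping.single v 1) 1"

definition irrelevant_ideal :: "'v set \<Rightarrow> ('v, 'k::comm_ring_1) mpoly set" where
  "irrelevant_ideal V = Idl\<^bsub>mpoly_ring V\<^esub> (Var ` V)"

definition edge_ideal :: "'v sgraph \<Rightarrow> ('v, 'k::comm_ring_1) mpoly set" where
  "edge_ideal G = Idl\<^bsub>mpoly_ring (verts G)\<^esub> {Var u * Var v | u v. {u, v} \<in> edges G}"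

text \<open>The component of degree \<open>a\<close> in the multigrading is spanned by the monomial with exponent
  \<open>a\<close>; it is zero if \<open>a\<close> has a negative entry, or an entry outside \<open>V\<close>.\<close>

definition mpoly_grading :: "'v set \<Rightarrow> ('v \<Rightarrow> int) \<Rightarrow> ('v, 'k::comm_ring_1) mpoly set" where
  "mpoly_grading V a =
    {p \<in> carrier (mpoly_ring V).
       \<forall>m \<in> Poly_Mapping.keys p. \<forall>v. int (Poly_Mapping.lookup m v) = a v}"

lemma cring_mpoly_ring:
  fixes V :: "'v set"
  shows "cring (mpoly_ring V :: ('v, 'k::comm_ring_1) mpoly ring)"
proof (rule cringI)
  show "abelian_group (mpoly_ring V :: ('v, 'k) mpoly ring)"
  proof (rule abelian_groupI)
    fix x :: "('v, 'k) mpoly" assume "x \<in> carrier (mpoly_ring V)"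
    then show "\<exists>y\<in>carrier (mpoly_ring V). y \<oplus>\<^bsub>mpoly_ring V\<^esub> x = \<zero>\<^bsub>mpoly_ring V\<^esub>"
      by (intro bexI[of _ "-x"]) (auto simp: mpoly_ring_def)
  qed (use Poly_Mapping.keys_add in \<open>fastforce simp: mpoly_ring_def algebra_simps\<close>)+
next
  have closed: "x * y \<in> carrier (mpoly_ring V)"
    if "x \<in> carrier (mpoly_ring V)" "y \<in> carrier (mpoly_ring V)"
    for x y :: "('v, 'k) mpoly"
  proof -
    have "Poly_Mapping.keys m \<subseteq> V" if "m \<in> Poly_Mapping.keys (x * y)" for m
    proof -
      obtain a b where "m = a + b" "a \<in> Poly_Mapping.keys x" "b \<in> Poly_Mapping.keys y"
        using \<open>m \<in> Poly_Mapping.keys (x * y)\<close> Poly_Mapping.keys_mult[of x y] by blast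
      moreover from this have "Poly_Mapping.keys a \<subseteq> V" "Poly_Mapping.keys b \<subseteq> V"
        using \<open>x \<in> _\<close> \<open>y \<in> _\<close> unfolding mpoly_ring_def by simp_all
      ultimately show ?thesis
        using Poly_Mapping.keys_add[of a b] by (metis Un_least order_trans)
    qed
    then show ?thesis by (simp add: mpoly_ring_def)
  qed
  show "comm_monoid (mpoly_ring V :: ('v, 'k) mpoly ring)"
  proof (rule comm_monoidI)
    fix x y :: "('v, 'k) mpoly"
    assume "x \<in> carrier (mpoly_ring V)" "y \<in> carrier (mpoly_ring V)"
    then show "x \<otimes>\<^bsub>mpoly_ring V\<^esub> y \<in> carrier (mpoly_ring V)"
      using closed[of x y] by (simp add: mpoly_ring_def)
  qed (simp_all add: mpoly_ring_def mult.assoc mult.commute)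
qed (simp add: mpoly_ring_def distrib_right)


section \<open>Quotient modules\<close>

text \<open>\<open>R/I\<close> as an \<open>R\<close>-module, i.e. the quotient ring with scalars restricted along \<open>R \<rightarrow> R/I\<close>.\<close>

definition quot_module :: "('a, 'b) ring_scheme \<Rightarrow> 'a set \<Rightarrow> ('a, 'a set) module" where
  "quot_module R I = ring.extend (R Quot I)
     (module.fields (\<lambda>r X. (I +>\<^bsub>R\<^esub> r) \<otimes>\<^bsub>R Quot I\<^esub> X))"

definition quot_grading :: "'v set \<Rightarrow> ('v, 'k::comm_ring_1) mpoly set \<Rightarrow>
    ('v \<Rightarrow> int) \<Rightarrow> ('v, 'k) mpoly set set" where
  "quot_grading V I a = (\<lambda>p. I +>\<^bsub>mpoly_ring V\<^esub> p) ` mpoly_grading V a"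

lemma quot_module_simps:
  "carrier (quot_module R I) = carrier (R Quot I)"
  "x \<oplus>\<^bsub>quot_module R I\<^esub> y = x \<oplus>\<^bsub>R Quot I\<^esub> y"
  "\<zero>\<^bsub>quot_module R I\<^esub> = \<zero>\<^bsub>R Quot I\<^esub>"
  "r \<odot>\<^bsub>quot_module R I\<^esub> x = (I +>\<^bsub>R\<^esub> r) \<otimes>\<^bsub>R Quot I\<^esub> x"
  by (simp_all add: quot_module_def ring.defs module.defs)

lemma module_quot_module:
  assumes "cring R" "ideal I R"
  shows "Module.module R (quot_module R I)"
proof -
  interpret R: cring R by fact
  interpret I: ideal I R by fact
  interpret Q: cring "R Quot I" by (rule I.quotient_is_cring) fact
  interpret h: ring_hom_ring R "R Quot I" "(+>\<^bsub>R\<^esub>) I" by (rule I.rcos_ring_hom_ring)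
  show ?thesis
  proof (rule moduleI)
    show "abelian_group (quot_module R I)"
    proof (rule abelian_groupI)
      fix x assume "x \<in> carrier (quot_module R I)"
      then show "\<exists>y\<in>carrier (quot_module R I). y \<oplus>\<^bsub>quot_module R I\<^esub> x = \<zero>\<^bsub>quot_module R I\<^esub>"
        by (intro bexI[of _ "\<ominus>\<^bsub>R Quot I\<^esub> x"]) (auto simp: quot_module_simps Q.l_neg)
    qed (simp_all add: quot_module_simps Q.a_assoc, rule Q.a_comm)
  qed (auto simp: quot_module_simps Q.l_distr Q.r_distr Q.m_assoc assms(1))
qed


section \<open>Depth\<close>

text \<open>\<open>(f\<^sub>1, \<dots>, f\<^sub>i)M\<close>, for a sequence \<open>fs\<close> of length at least \<open>i\<close>.\<close>

definition seq_submodule ::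
    "('a, 'c) ring_scheme \<Rightarrow> ('a, 'b, 'd) module_scheme \<Rightarrow> 'a list \<Rightarrow> nat \<Rightarrow> 'b set" where
  "seq_submodule R M fs i =
    {\<Oplus>\<^bsub>M\<^esub>j\<in>{..<i}. (fs ! j) \<odot>\<^bsub>M\<^esub> y j | y. y \<in> {..<i} \<rightarrow> carrier M}"

text \<open>The first condition says that \<open>f\<^sub>i\<^sub>+\<^sub>1\<close> is a nonzerodivisor on \<open>M/(f\<^sub>1, \<dots>, f\<^sub>i)M\<close>.\<close>

definition regular_sequence ::
    "('a, 'c) ring_scheme \<Rightarrow> ('a, 'b, 'd) module_scheme \<Rightarrow> 'a list \<Rightarrow> bool" where
  "regular_sequence R M fs \<longleftrightarrow>
    set fs \<subseteq> carrier R \<and>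
    (\<forall>i < length fs. \<forall>x \<in> carrier M.
       (fs ! i) \<odot>\<^bsub>M\<^esub> x \<in> seq_submodule R M fs i \<longrightarrow> x \<in> seq_submodule R M fs i) \<and>
    seq_submodule R M fs (length fs) \<noteq> carrier M"

text \<open>The supremum, taken in \<^typ>\<open>enat\<close>, is a maximum whenever it is finite and \<open>M \<noteq> 0\<close>.\<close>

definition depth ::
    "('a, 'c) ring_scheme \<Rightarrow> 'a set \<Rightarrow> ('a, 'b, 'd) module_scheme \<Rightarrow> enat" where
  "depth R J M = (SUP fs \<in> {fs. set fs \<subseteq> J \<and> regular_sequence R M fs}. enat (length fs))"


section \<open>Stanley depth\<close>

definition free_module ::
    "('a, 'c) ring_scheme \<Rightarrow> ('a, 'b, 'd) module_scheme \<Rightarrow> bool" where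
  "free_module R M \<longleftrightarrow>
    (\<exists>B \<subseteq> carrier M. \<forall>x \<in> carrier M. \<exists>!c.
       c \<in> B \<rightarrow> carrier R \<and> (\<forall>b. b \<notin> B \<longrightarrow> c b = \<zero>\<^bsub>R\<^esub>) \<and> finite {b. c b \<noteq> \<zero>\<^bsub>R\<^esub>} \<and>
       x = (\<Oplus>\<^bsub>M\<^esub>b\<in>{b. c b \<noteq> \<zero>\<^bsub>R\<^esub>}. c b \<odot>\<^bsub>M\<^esub> b))"

text \<open>\<open>w K[A]\<close>\<close>

definition stanley_space ::
    "(('v, 'k::comm_ring_1) mpoly, 'm, 'd) module_scheme \<Rightarrow> 'm \<Rightarrow> 'v set \<Rightarrow> 'm set" where
  "stanley_space M w A = (\<lambda>p. p \<odot>\<^bsub>M\<^esub> w) ` carrier (mpoly_ring A)"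

text \<open>Here \<open>M\<close> is a module over \<open>mpoly_ring V\<close>, and \<open>gr a\<close> is its component of degree \<open>a\<close>. The last
  condition says that \<open>M\<close> is the internal direct sum of the Stanley spaces.\<close>

definition stanley_decomposition ::
    "'v set \<Rightarrow> (('v \<Rightarrow> int) \<Rightarrow> 'm set) \<Rightarrow> (('v, 'k::comm_ring_1) mpoly, 'm, 'd) module_scheme \<Rightarrow>
     ('m \<times> 'v set) list \<Rightarrow> bool" where
  "stanley_decomposition V gr M D \<longleftrightarrow>
    (\<forall>(w, A) \<in> set D. w \<in> carrier M \<and> (\<exists>a. w \<in> gr a) \<and> A \<subseteq> V \<and>
       free_module (mpoly_ring A :: ('v, 'k) mpoly ring)
         (M\<lparr>carrier := stanley_space M w A\<rparr>)) \<and>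
    (\<forall>x \<in> carrier M. \<exists>!u.
       u \<in> (\<Pi>\<^sub>E i\<in>{..<length D}. stanley_space M (fst (D ! i)) (snd (D ! i))) \<and>
       x = (\<Oplus>\<^bsub>M\<^esub>i\<in>{..<length D}. u i))"

text \<open>The set \<open>V\<close> is meant to be finite, so that the cardinalities are those of finite sets, and
  \<open>M\<close> to be nonzero, so that the infimum is a minimum over a nonempty set.\<close>

definition sdepth ::
    "'v set \<Rightarrow> (('v \<Rightarrow> int) \<Rightarrow> 'm set) \<Rightarrow> (('v, 'k::comm_ring_1) mpoly, 'm, 'd) module_scheme \<Rightarrow>
     enat" where
  "sdepth V gr M =
    (SUP D \<in> {D. stanley_decomposition V gr M D}. INF (w, A) \<in> set D. enat (card A))"

end

theory Submission
  imports Defs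
begin

text \<open>Let \<open>G\<close> be a finite simple graph. Call a set of vertices a packing if its closed neighbourhoods
  are pairwise disjoint. For every packing \<open>A\<close> and every independent dominating set \<open>D\<close>, both the
  depth and the Stanley depth of \<open>S/I(G)\<close>, where \<open>S = K[V]\<close>, lie between \<open>|A|\<close> and \<open>|D|\<close>. In the
  strong product of \<open>P\<^sub>n\<close> with \<open>P\<^sub>3\<close> the vertices in rows \<open>1, 4, 7, \<dots>\<close> of the middle column form a packing, and those
  in rows \<open>2, 5, 8, \<dots>\<close> (with row \<open>n\<close> in place of row \<open>n + 1\<close> if that comes up) form an independent dominating
  set. Both have \<open>\<lceil>n/3\<rceil>\<close> elements, so the four bounds coincide.
  
  Stanley depth, lower bound (\<open>sdepth_ge\<close>). The monomials outside \<open>I(G)\<close> are those with independent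
  support. Each independent set lies in exactly one interval from \<open>F\<close> to
  \<open>F \<union> {a \<in> A. F contains no neighbour of a}\<close>, where \<open>F\<close> is independent and disjoint from \<open>A\<close>. An
  interval \<open>[F, T]\<close> of independent sets gives the Stanley space \<open>x\<^sup>F K[T]\<close>. The top of each interval
  contains, for every \<open>a \<in> A\<close>, either \<open>a\<close> or a neighbour of \<open>a\<close>, hence at least \<open>|A|\<close> vertices.
  
  Stanley depth, upper bound (\<open>sdepth_le\<close>). Every variable outside \<open>D\<close> kills the monomial \<open>x\<^sup>D\<close>, so the
  Stanley space that contributes to \<open>x\<^sup>D\<close> can only use variables of \<open>D\<close>.
  
  Depth, lower bound (\<open>depth_ge\<close>). The linear forms \<open>\<theta>\<^sub>a\<close>, the sums of the variables in the closed
  neighbourhood of \<open>a \<in> A\<close>, form a regular sequence. Regularity on \<open>S/J\<close> follows from regularity on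
  \<open>S/(J : y)\<close> and \<open>S/(J + y)\<close> (\<open>weakly_regular_split\<close>). For \<open>J = I(G)\<close> and a vertex \<open>y\<close> next to some
  \<open>a \<in> A\<close>, the first quotient isolates \<open>y\<close> and the second deletes \<open>y\<close>. Repeating this, every
  \<open>\<theta>\<^sub>a\<close> eventually involves an isolated vertex \<open>z\<close>. There \<open>\<theta>\<^sub>a = z + q\<close> with \<open>q\<close> free of \<open>z\<close>, over
  an ideal that does not involve \<open>z\<close>, and such an element is a nonzerodivisor by its leading coefficient.
  
  Depth, upper bound (\<open>depth_le\<close>). The annihilator of \<open>x\<^sup>D\<close> is generated by the variables outside \<open>D\<close>,
  so \<open>x\<^sup>D\<close> generates a copy of the polynomial ring \<open>K[D]\<close>. In it, more than \<open>|D|\<close> elements are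
  algebraically dependent. If \<open>f\<close> is a regular sequence on \<open>S/I\<close>, then so is the sequence of powers
  \<open>f\<^sub>i\<^sup>N\<close> (\<open>weakly_regular_powers\<close>). Cancelling in an algebraic relation among these powers, applied
  to \<open>x\<^sup>D\<close>, from its lexicographically smallest term leads to \<open>x\<^sup>D \<in> I + (f\<^sub>i\<^sup>N)\<close>
  (\<open>weakly_regular_relation\<close>). If the \<open>f\<^sub>i\<close> have no constant terms and \<open>N > |D|\<close>, this is
  impossible for degree reasons. This replaces the usual argument with associated primes and Krull
  dimension, and it covers inhomogeneous sequences.\<close>

section \<open>Weakly regular sequences\<close>

text \<open>Polynomial rings in different sets of variables are subsets of one type, so a ring is a subset \<open>R\<close>
  here. A cyclic module \<open>R/J\<close> is represented by the ideal \<open>J\<close>; its quotient by \<open>f\<close> is then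
  represented by \<open>J + fR\<close>, which makes regularity a recursion over the sequence.\<close>

locale subring_set =
  fixes R :: "'a::comm_ring_1 set"
  assumes one_closed: "1 \<in> R"
    and diff_closed: "a \<in> R \<Longrightarrow> b \<in> R \<Longrightarrow> a - b \<in> R"
    and mult_closed: "a \<in> R \<Longrightarrow> b \<in> R \<Longrightarrow> a * b \<in> R"
begin

lemma zero_closed: "0 \<in> R"
  using diff_closed[OF one_closed one_closed] by simp

lemma uminus_closed: "a \<in> R \<Longrightarrow> - a \<in> R"
  using diff_closed[OF zero_closed] by fastforce

lemma add_closed: "a \<in> R \<Longrightarrow> b \<in> R \<Longrightarrow> a + b \<in> R"
  using diff_closed[OF _ uminus_closed] by fastforce

lemma power_closed: "a \<in> R \<Longrightarrow> a ^ n \<in> R"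
  by (induction n) (auto simp: one_closed mult_closed)

lemma sum_closed: "(\<And>i. i \<in> T \<Longrightarrow> f i \<in> R) \<Longrightarrow> sum f T \<in> R"
  by (induction T rule: infinite_finite_induct) (auto simp: zero_closed add_closed)

definition is_ideal :: "'a set \<Rightarrow> bool" where
  "is_ideal J \<longleftrightarrow> J \<subseteq> R \<and> 0 \<in> J \<and> (\<forall>a\<in>J. \<forall>b\<in>J. a + b \<in> J) \<and> (\<forall>r\<in>R. \<forall>a\<in>J. r * a \<in> J)"

lemma ideal_sub: "is_ideal J \<Longrightarrow> a \<in> J \<Longrightarrow> a \<in> R"
  and ideal_zero: "is_ideal J \<Longrightarrow> 0 \<in> J"
  and ideal_add: "is_ideal J \<Longrightarrow> a \<in> J \<Longrightarrow> b \<in> J \<Longrightarrow> a + b \<in> J"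
  and ideal_mult: "is_ideal J \<Longrightarrow> r \<in> R \<Longrightarrow> a \<in> J \<Longrightarrow> r * a \<in> J"
  unfolding is_ideal_def by auto

lemma ideal_mult_right: "is_ideal J \<Longrightarrow> a \<in> J \<Longrightarrow> r \<in> R \<Longrightarrow> a * r \<in> J"
  by (subst mult.commute) (rule ideal_mult)

lemma ideal_uminus: "is_ideal J \<Longrightarrow> a \<in> J \<Longrightarrow> - a \<in> J"
  using ideal_mult[OF _ uminus_closed[OF one_closed]] by fastforce

lemma ideal_diff: "is_ideal J \<Longrightarrow> a \<in> J \<Longrightarrow> b \<in> J \<Longrightarrow> a - b \<in> J"
  using ideal_add[OF _ _ ideal_uminus] by fastforce

lemma ideal_sum: "is_ideal J \<Longrightarrow> (\<And>i. i \<in> T \<Longrightarrow> f i \<in> J) \<Longrightarrow> sum f T \<in> J"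
  by (induction T rule: infinite_finite_induct) (auto simp: ideal_zero ideal_add)

definition adjoin :: "'a set \<Rightarrow> 'a \<Rightarrow> 'a set" where
  "adjoin J f = {j + f * r | j r. j \<in> J \<and> r \<in> R}"

primrec adjoin_list :: "'a set \<Rightarrow> 'a list \<Rightarrow> 'a set" where
  "adjoin_list J [] = J"
| "adjoin_list J (f # fs) = adjoin_list (adjoin J f) fs"

definition colon :: "'a set \<Rightarrow> 'a \<Rightarrow> 'a set" where
  "colon J y = {x \<in> R. x * y \<in> J}"

definition nzd :: "'a \<Rightarrow> 'a set \<Rightarrow> bool" where
  "nzd f J \<longleftrightarrow> (\<forall>x\<in>R. f * x \<in> J \<longrightarrow> x \<in> J)"

text \<open>The condition that the quotient by all of \<open>fs\<close> be nonzero is left out: it is not inherited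
  by the quotients and colon ideals that the inductions pass to.\<close>

primrec weakly_regular :: "'a set \<Rightarrow> 'a list \<Rightarrow> bool" where
  "weakly_regular J [] \<longleftrightarrow> True"
| "weakly_regular J (f # fs) \<longleftrightarrow> nzd f J \<and> weakly_regular (adjoin J f) fs"

lemma nzdD: "nzd f J \<Longrightarrow> x \<in> R \<Longrightarrow> f * x \<in> J \<Longrightarrow> x \<in> J"
  unfolding nzd_def by blast

lemma adjoinI: "j \<in> J \<Longrightarrow> r \<in> R \<Longrightarrow> x = j + f * r \<Longrightarrow> x \<in> adjoin J f"
  unfolding adjoin_def by blast

lemma adjoinE:
  assumes "x \<in> adjoin J f"
  obtains j r where "j \<in> J" "r \<in> R" "x = j + f * r"
  using assms unfolding adjoin_def by blast

lemma is_ideal_adjoin: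
  assumes "is_ideal J" "f \<in> R"
  shows "is_ideal (adjoin J f)"
  unfolding is_ideal_def
proof (intro conjI ballI)
  show "adjoin J f \<subseteq> R"
    using assms by (auto simp: adjoin_def intro!: add_closed mult_closed intro: ideal_sub)
  show "0 \<in> adjoin J f"
    by (rule adjoinI[of 0 _ 0]) (auto simp: ideal_zero assms zero_closed)
next
  fix a b assume "a \<in> adjoin J f" "b \<in> adjoin J f"
  then obtain j r j' r' where "j \<in> J" "r \<in> R" "a = j + f * r" "j' \<in> J" "r' \<in> R" "b = j' + f * r'"
    by (auto elim!: adjoinE)
  then show "a + b \<in> adjoin J f"
    by (intro adjoinI[of "j + j'" _ "r + r'"])
      (auto intro: ideal_add assms add_closed simp: algebra_simps)
next
  fix s a assume "s \<in> R" "a \<in> adjoin J f"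
  then obtain j r where "j \<in> J" "r \<in> R" "a = j + f * r" by (auto elim!: adjoinE)
  then show "s * a \<in> adjoin J f"
    by (intro adjoinI[of "s * j" _ "s * r"])
      (auto intro: ideal_mult[OF assms(1)] mult_closed \<open>s \<in> R\<close> simp: distrib_left mult.left_commute)
qed

lemma is_ideal_adjoin_list: "is_ideal J \<Longrightarrow> set fs \<subseteq> R \<Longrightarrow> is_ideal (adjoin_list J fs)"
  by (induction fs arbitrary: J) (auto simp: is_ideal_adjoin)

lemma adjoin_commute: "adjoin (adjoin J f) g = adjoin (adjoin J g) f"
proof -
  have "adjoin (adjoin J f) g \<subseteq> adjoin (adjoin J g) f" for f g
  proof
    fix x assume "x \<in> adjoin (adjoin J f) g"
    then obtain j r s where "j \<in> J" "r \<in> R" "s \<in> R" "x = (j + f * r) + g * s"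
      by (auto elim!: adjoinE)
    then show "x \<in> adjoin (adjoin J g) f"
      by (intro adjoinI[OF adjoinI[of j J s _ g], of _ r]) (auto simp: algebra_simps)
  qed
  then show ?thesis by blast
qed

lemma adjoin_list_snoc: "adjoin_list J (fs @ [f]) = adjoin (adjoin_list J fs) f"
  by (induction fs arbitrary: J) auto

lemma adjoin_list_iff:
  "x \<in> adjoin_list J fs \<longleftrightarrow>
    (\<exists>y \<in> {..<length fs} \<rightarrow> R. x - (\<Sum>i<length fs. fs ! i * y i) \<in> J)"
proof (induction fs arbitrary: x rule: rev_induct)
  case Nil
  show ?case by auto
next
  case (snoc f fs)
  show ?case (is "?L \<longleftrightarrow> ?R")
  proof
    assume ?L
    then obtain z r where z: "z \<in> adjoin_list J fs" "r \<in> R" "x = z + f * r"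
      by (auto simp: adjoin_list_snoc elim!: adjoinE)
    then obtain y where y: "y \<in> {..<length fs} \<rightarrow> R" "z - (\<Sum>i<length fs. fs ! i * y i) \<in> J"
      using snoc.IH by blast
    then show ?R using z
      by (intro bexI[of _ "y(length fs := r)"]) (auto simp: nth_append Pi_def)
  next
    assume ?R
    then obtain y where y: "y \<in> {..length fs} \<rightarrow> R"
        "x - ((\<Sum>i<length fs. fs ! i * y i) + f * y (length fs)) \<in> J"
      by (auto simp: nth_append lessThan_Suc_atMost[symmetric])
    then have "x - f * y (length fs) \<in> adjoin_list J fs"
      unfolding snoc.IH by (intro bexI[of _ y]) (auto simp: algebra_simps)
    then show ?L using y(1)
      by (auto simp: adjoin_list_snoc intro!: adjoinI[of "x - f * y (length fs)" _ "y (length fs)"])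
  qed
qed

lemma weakly_regular_iff:
  "weakly_regular J fs \<longleftrightarrow> (\<forall>i<length fs. nzd (fs ! i) (adjoin_list J (take i fs)))"
proof (induction fs arbitrary: J)
  case (Cons f fs)
  show ?case by (auto simp: Cons.IH less_Suc_eq_0_disj)
qed auto

text \<open>This is the half of the exchange of \<open>a\<close> and \<open>h\<close> in a regular sequence that holds without
  a local hypothesis; the other half, that \<open>h\<close> is a nonzerodivisor on \<open>R/J\<close> itself, can fail. From
  \<open>a x = h y\<close> in \<open>R/J\<close> one gets \<open>y = a z\<close> because \<open>h\<close> is regular modulo
  \<open>a\<close>, and then \<open>x = h z\<close> by cancelling \<open>a\<close>.\<close>

lemma nzd_swap:
  assumes J: "is_ideal J" and R: "a \<in> R" "h \<in> R"
    and "nzd a J" "nzd h (adjoin J a)"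
  shows "nzd a (adjoin J h)"
  unfolding nzd_def
proof (intro ballI impI)
  fix x assume x: "x \<in> R" "a * x \<in> adjoin J h"
  then obtain j y where y: "j \<in> J" "y \<in> R" "a * x = j + h * y" by (auto elim!: adjoinE)
  then have "h * y \<in> adjoin J a"
    by (intro adjoinI[of "- j" _ x]) (auto simp: x ideal_uminus J)
  then have "y \<in> adjoin J a" using nzdD[OF assms(5)] y by blast
  then obtain j' z where z: "j' \<in> J" "z \<in> R" "y = j' + a * z"
    by (auto elim!: adjoinE)
  have "a * (x - h * z) = j + h * j'" using y z by (simp add: algebra_simps)
  also have "\<dots> \<in> J" using y z R by (simp add: ideal_add ideal_mult J)
  finally have "x - h * z \<in> J"
    by (rule nzdD[OF assms(4), rotated]) (auto intro!: diff_closed mult_closed x z R)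
  then show "x \<in> adjoin J h" by (rule adjoinI[of _ _ z]) (auto simp: z)
qed

text \<open>The module \<open>R/(J + ab)\<close> is an extension of \<open>R/(J + a)\<close> by \<open>a R/(J + ab)\<close>, which is isomorphic to
  \<open>R/(J + b)\<close> when \<open>a\<close> is a nonzerodivisor. The proof is the long exact sequence written out for
  elements, one member of the sequence at a time.\<close>

lemma weakly_regular_mult:
  assumes "is_ideal J" "a \<in> R" "b \<in> R" "set g \<subseteq> R" "nzd a J"
    and "weakly_regular (adjoin J a) g" "weakly_regular (adjoin J b) g"
  shows "weakly_regular (adjoin J (a * b)) g"
  using assms
proof (induction g arbitrary: J)
  case (Cons h g)
  note J = \<open>is_ideal J\<close>
  have h: "h \<in> R" using Cons.prems by simp
  have na: "nzd h (adjoin J a)" and nbhd: "nzd h (adjoin J b)" using Cons.prems by auto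
  have "nzd h (adjoin J (a * b))" unfolding nzd_def
  proof (intro ballI impI)
    fix x assume x: "x \<in> R" "h * x \<in> adjoin J (a * b)"
    then obtain j y where y: "j \<in> J" "y \<in> R" "h * x = j + a * b * y" by (auto elim!: adjoinE)
    then have "h * x \<in> adjoin J a"
      by (intro adjoinI[of j _ "b * y"]) (auto simp: mult_closed Cons.prems algebra_simps)
    then have "x \<in> adjoin J a" using nzdD[OF na] x by blast
    then obtain j' x' where x': "j' \<in> J" "x' \<in> R" "x = j' + a * x'"
      by (auto elim!: adjoinE)
    have "a * (h * x' - b * y) = j - h * j'" using y x' by (simp add: algebra_simps)
    also have "\<dots> \<in> J" using y x' h by (simp add: ideal_diff ideal_mult J)
    finally have "h * x' - b * y \<in> J"
      by (rule nzdD[OF \<open>nzd a J\<close>, rotated])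
        (use Cons.prems in \<open>auto intro!: diff_closed mult_closed x' y h\<close>)
    then have "h * x' \<in> adjoin J b" by (rule adjoinI[of _ _ y]) (auto simp: y)
    then have "x' \<in> adjoin J b" using nzdD[OF nbhd] x' by blast
    then obtain j'' z where z: "j'' \<in> J" "z \<in> R" "x' = j'' + b * z"
      by (auto elim!: adjoinE)
    have "j' + a * j'' \<in> J" using x' z Cons.prems by (simp add: ideal_add ideal_mult J)
    then show "x \<in> adjoin J (a * b)"
      by (rule adjoinI[of _ _ z]) (auto simp: z x' algebra_simps)
  qed
  moreover have "weakly_regular (adjoin (adjoin J h) (a * b)) g"
    by (rule Cons.IH)
      (use Cons.prems in \<open>auto intro: nzd_swap is_ideal_adjoin simp: adjoin_commute[of J h]\<close>)
  ultimately show ?case by (simp add: adjoin_commute[of J h])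
qed simp

lemma nzd_power: "f \<in> R \<Longrightarrow> nzd f J \<Longrightarrow> nzd (f ^ n) J"
proof (induction n)
  case (Suc n)
  show ?case unfolding nzd_def
  proof (intro ballI impI)
    fix x assume x: "x \<in> R" "f ^ Suc n * x \<in> J"
    then have "f ^ n * x \<in> J"
      by (intro nzdD[of f J "f ^ n * x"]) (simp_all add: Suc.prems mult_closed power_closed mult.assoc)
    then show "x \<in> J" using Suc x nzdD by blast
  qed
qed (simp add: nzd_def)

lemma weakly_regular_power:
  assumes "is_ideal J" "f \<in> R" "set g \<subseteq> R" "nzd f J" "weakly_regular (adjoin J f) g"
  shows "weakly_regular (adjoin J (f ^ Suc n)) g"
proof (induction n)
  case (Suc n)
  have "weakly_regular (adjoin J (f * f ^ Suc n)) g"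
    by (rule weakly_regular_mult) (use assms Suc power_closed[of f "Suc n"] in auto)
  then show ?case by simp
qed (use assms in simp)

lemma weakly_regular_powers:
  assumes "is_ideal J" "set fs \<subseteq> R" "weakly_regular J fs"
  shows "weakly_regular J (map (\<lambda>f. f ^ Suc n) fs)"
  using assms
proof (induction fs arbitrary: J)
  case (Cons f fs)
  have "f ^ Suc n \<in> R" using Cons.prems by (intro power_closed) auto
  then show ?case
    using Cons nzd_power[of f J "Suc n"] weakly_regular_power[of J f fs n]
      Cons.IH[of "adjoin J (f ^ Suc n)"] is_ideal_adjoin[of J "f ^ Suc n"]
    by (auto simp del: power_Suc)
qed simp

text \<open>The same principle for the exact sequence
  \<open>0 \<rightarrow> R/(J : y) \<rightarrow> R/J \<rightarrow> R/(J + y) \<rightarrow> 0\<close>, whose first map is multiplication by \<open>y\<close>.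
  The induction goes through because adjoining the head \<open>h\<close> of the sequence commutes not only with
  adjoining \<open>y\<close> but, thanks to regularity modulo \<open>y\<close>, also with forming the colon ideal.\<close>

lemma weakly_regular_split:
  assumes "is_ideal J" "y \<in> R" "set g \<subseteq> R"
    and "weakly_regular (colon J y) g" "weakly_regular (adjoin J y) g"
  shows "weakly_regular J g"
  using assms
proof (induction g arbitrary: J)
  case (Cons h g)
  note J = \<open>is_ideal J\<close>
  have h: "h \<in> R" using Cons.prems by simp
  have nc: "nzd h (colon J y)" and na: "nzd h (adjoin J y)" using Cons.prems by auto
  have "nzd h J" unfolding nzd_def
  proof (intro ballI impI)
    fix x assume x: "x \<in> R" "h * x \<in> J"
    then have "h * x \<in> adjoin J y"
      by (intro adjoinI[of "h * x" _ 0]) (auto simp: zero_closed)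
    then have "x \<in> adjoin J y" using nzdD[OF na] x by blast
    then obtain j z where z: "j \<in> J" "z \<in> R" "x = j + y * z"
      by (auto elim!: adjoinE)
    have "h * z * y = h * x - h * j" using z by (simp add: algebra_simps)
    also have "\<dots> \<in> J" using x z h by (simp add: ideal_diff ideal_mult J)
    finally have "h * z \<in> colon J y" using h z by (simp add: colon_def mult_closed)
    then have "z * y \<in> J" using nzdD[OF nc] z by (simp add: colon_def)
    then show "x \<in> J" using z by (simp add: ideal_add J mult.commute)
  qed
  moreover have "colon (adjoin J h) y = adjoin (colon J y) h"
  proof (intro equalityI subsetI)
    fix z assume "z \<in> colon (adjoin J h) y"
    then obtain j x where x: "z \<in> R" "j \<in> J" "x \<in> R" "z * y = j + h * x"
      by (auto simp: colon_def elim!: adjoinE)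
    then have "h * x \<in> adjoin J y"
      by (intro adjoinI[of "- j" _ z]) (auto simp: ideal_uminus J algebra_simps)
    then have "x \<in> adjoin J y" using nzdD[OF na] x by blast
    then obtain j' x' where x': "j' \<in> J" "x' \<in> R" "x = j' + y * x'"
      by (auto elim!: adjoinE)
    have "(z - h * x') * y = j + h * j'" using x x' by (simp add: algebra_simps)
    also have "\<dots> \<in> J" using x x' h by (simp add: ideal_add ideal_mult J)
    finally have "z - h * x' \<in> colon J y"
      using x x' h by (simp add: colon_def diff_closed mult_closed)
    then show "z \<in> adjoin (colon J y) h"
      by (rule adjoinI[of _ _ x']) (auto simp: x')
  next
    fix z assume "z \<in> adjoin (colon J y) h"
    then obtain j x where x: "j \<in> R" "j * y \<in> J" "x \<in> R" "z = j + h * x"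
      by (auto simp: colon_def elim!: adjoinE)
    then have "z * y \<in> adjoin J h"
      by (intro adjoinI[of "j * y" _ "x * y"])
        (auto simp: mult_closed Cons.prems algebra_simps)
    then show "z \<in> colon (adjoin J h) y" using x h
      by (auto simp: colon_def intro!: add_closed mult_closed)
  qed
  then have "weakly_regular (colon (adjoin J h) y) g" using Cons.prems by simp
  then have "weakly_regular (adjoin J h) g"
    by (rule Cons.IH[rotated 3])
      (use Cons.prems in \<open>auto simp: is_ideal_adjoin adjoin_commute[of J h y]\<close>)
  ultimately show ?case by simp
qed simp

text \<open>Elements of a regular sequence satisfy no nontrivial polynomial relation on \<open>u\<close>, unless \<open>u\<close> already
  vanishes modulo the sequence. Let \<open>e\<close> be the smallest exponent of the first element \<open>f\<close> in the
  relation. After cancelling \<open>f\<^sup>e\<close>, the terms with a larger exponent vanish modulo \<open>f\<close>, and the others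
  form a relation among the remaining elements. The coefficients are units because only the
  coefficient itself is left when the sequence is exhausted.\<close>

lemma weakly_regular_relation:
  assumes "is_ideal J" "set fs \<subseteq> R" "u \<in> R" "weakly_regular J fs"
    and "finite E" "E \<noteq> {}" "\<And>b. b \<in> E \<Longrightarrow> length b = length fs"
    and "\<And>b. b \<in> E \<Longrightarrow> c b \<in> R \<and> (\<exists>d\<in>R. d * c b = 1)"
    and "(\<Sum>b\<in>E. c b * (\<Prod>i<length fs. fs ! i ^ (b ! i))) * u \<in> J"
  shows "u \<in> adjoin_list J fs"
  using assms
proof (induction fs arbitrary: J E c)
  case Nil
  have "E = {[]}" using Nil.prems(6,7) by fastforce
  then obtain d where "d \<in> R" "d * c [] = 1" "c [] * u \<in> J" using Nil.prems(8,9) by auto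
  have "d * c [] * u \<in> J"
    using ideal_mult[OF Nil.prems(1) \<open>d \<in> R\<close> \<open>c [] * u \<in> J\<close>] by (simp add: mult.assoc)
  then show ?case using \<open>d * c [] = 1\<close> by simp
next
  case (Cons f fs)
  note J = \<open>is_ideal J\<close> and E = \<open>finite E\<close>
  have f: "f \<in> R" and fs: "set fs \<subseteq> R" using Cons.prems by auto
  let ?m = "\<lambda>b. \<Prod>i<length fs. fs ! i ^ (b ! i)"
  have m: "?m b \<in> R" for b
  proof -
    have "(\<Prod>i\<in>T. fs ! i ^ (b ! i)) \<in> R" if "T \<subseteq> {..<length fs}" for T
      using finite_subset[OF that] that
      by (induction T rule: finite_induct)
        (use fs in \<open>auto intro!: mult_closed power_closed one_closed\<close>)
    then show ?thesis by blast
  qed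
  define e where "e = Min (hd ` E)"
  have e: "e \<in> hd ` E" "\<And>b. b \<in> E \<Longrightarrow> e \<le> hd b"
    using Cons.prems by (auto simp: e_def)
  define E0 where "E0 = {b \<in> E. hd b = e}"
  have ne: "b \<noteq> []" if "b \<in> E" for b using Cons.prems(7)[OF that] by auto
  have split: "(\<Prod>i<length (f # fs). (f # fs) ! i ^ (b ! i)) = f ^ hd b * ?m (tl b)"
    if "b \<in> E" for b
  proof -
    have "(\<Prod>i<length (f # fs). (f # fs) ! i ^ (b ! i)) =
        f ^ (b ! 0) * (\<Prod>i<length fs. fs ! i ^ (b ! Suc i))"
      unfolding length_Cons prod.lessThan_Suc_shift by simp
    then show ?thesis using ne[OF that] by (cases b) auto
  qed
  define s where "s = (\<Sum>b\<in>E0. c b * ?m (tl b))"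
  define t where "t = (\<Sum>b\<in>E-E0. c b * (f ^ (hd b - Suc e) * ?m (tl b)))"
  have sR: "s \<in> R" unfolding s_def E0_def
    using Cons.prems(8) m by (intro sum_closed mult_closed) auto
  have tR: "t \<in> R" unfolding t_def
    using Cons.prems(8) m f by (intro sum_closed mult_closed power_closed) auto
  have "(\<Sum>b\<in>E. c b * (\<Prod>i<length (f # fs). (f # fs) ! i ^ (b ! i))) =
      (\<Sum>b\<in>E. c b * (f ^ hd b * ?m (tl b)))"
    using split by (intro sum.cong) auto
  also have "\<dots> = (\<Sum>b\<in>E0. c b * (f ^ hd b * ?m (tl b))) + (\<Sum>b\<in>E-E0. c b * (f ^ hd b * ?m (tl b)))"
    using E by (subst sum.subset_diff[of E0 E]) (auto simp: E0_def)
  also have "(\<Sum>b\<in>E0. c b * (f ^ hd b * ?m (tl b))) = f ^ e * s"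
    unfolding s_def sum_distrib_left by (intro sum.cong) (auto simp: E0_def)
  also have "(\<Sum>b\<in>E-E0. c b * (f ^ hd b * ?m (tl b))) = f ^ e * (f * t)"
    unfolding t_def sum_distrib_left
  proof (intro sum.cong refl)
    fix b assume "b \<in> E - E0"
    then have "hd b = e + Suc (hd b - Suc e)" using e(2)[of b] by (auto simp: E0_def)
    then have "f ^ hd b = f ^ e * (f * f ^ (hd b - Suc e))" by (metis power_add power_Suc)
    then show "c b * (f ^ hd b * ?m (tl b)) = f ^ e * (f * (c b * (f ^ (hd b - Suc e) * ?m (tl b))))"
      by (simp add: mult_ac)
  qed
  finally have "f ^ e * ((s + f * t) * u) \<in> J"
    using Cons.prems(9) by (simp add: algebra_simps)
  then have "(s + f * t) * u \<in> J"
    using nzd_power[of f J e] Cons.prems f sR tR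
    by (auto intro!: nzdD[of "f ^ e" J] mult_closed add_closed)
  then have su: "s * u \<in> adjoin J f"
    by (rule adjoinI[of _ _ "- (t * u)"])
      (use tR Cons.prems(3) in \<open>auto simp: algebra_simps intro!: uminus_closed mult_closed\<close>)
  have inj: "inj_on tl E0" using ne by (auto simp: inj_on_def E0_def) (metis list.collapse)
  define c' where "c' b = c (e # b)" for b
  have cons: "e # tl b = b" if "b \<in> E0" for b using ne[of b] that by (cases b) (auto simp: E0_def)
  have "s = (\<Sum>b\<in>tl ` E0. c' b * ?m b)"
    unfolding s_def sum.reindex[OF inj] by (intro sum.cong) (auto simp: c'_def cons)
  with su have su': "(\<Sum>b\<in>tl ` E0. c' b * ?m b) * u \<in> adjoin J f" by simp
  show ?case unfolding adjoin_list.simps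
  proof (rule Cons.IH[OF _ fs Cons.prems(3) _ _ _ _ _ su'])
    show "c' b \<in> R \<and> (\<exists>d\<in>R. d * c' b = 1)" if "b \<in> tl ` E0" for b
      using that Cons.prems(8) cons by (auto simp: c'_def E0_def)
  qed (use Cons.prems e(1) in \<open>auto simp: is_ideal_adjoin E0_def\<close>)
qed

end

section \<open>Polynomials and monomials\<close>

lemma mpoly_expand: "p = (\<Sum>m\<in>Poly_Mapping.keys p. Poly_Mapping.single m (Poly_Mapping.lookup p m))"
  by (rule poly_mapping_eqI)
    (auto simp: lookup_sum lookup_single when_def in_keys_iff sum.delta)

lemma mpoly_induct [case_names zero single add]:
  fixes p :: "'a \<Rightarrow>\<^sub>0 'b::comm_monoid_add"
  assumes "P 0" "\<And>m c. c \<noteq> 0 \<Longrightarrow> m \<in> Poly_Mapping.keys p \<Longrightarrow> P (Poly_Mapping.single m c)"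
    and "\<And>a b. P a \<Longrightarrow> P b \<Longrightarrow> P (a + b)"
  shows "P p"
proof -
  have "P (\<Sum>m\<in>T. Poly_Mapping.single m (Poly_Mapping.lookup p m))" if "T \<subseteq> Poly_Mapping.keys p" for T
    using finite_subset[OF that finite_keys] that
    by (induction T rule: finite_induct) (auto intro!: assms simp: in_keys_iff)
  from this[OF order_refl] show ?thesis by (simp flip: mpoly_expand)
qed

lemma lookup_single_mult:
  fixes p :: "('a::cancel_comm_monoid_add) \<Rightarrow>\<^sub>0 'b::comm_semiring_0"
  shows "Poly_Mapping.lookup (Poly_Mapping.single a c * p) (a + m) = c * Poly_Mapping.lookup p m"
proof (induction p rule: mpoly_induct)
  case (single k d)
  then show ?case by (simp add: mult_single lookup_single when_def)
qed (simp_all add: lookup_add distrib_left)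

lemma keys_monom_add:
  fixes a b :: "'v \<Rightarrow>\<^sub>0 nat"
  shows "Poly_Mapping.keys (a + b) = Poly_Mapping.keys a \<union> Poly_Mapping.keys b"
  by (auto simp: in_keys_iff lookup_add)

lemma keys_diff_subset:
  fixes p q :: "'a \<Rightarrow>\<^sub>0 'b::ab_group_add"
  shows "Poly_Mapping.keys (p - q) \<subseteq> Poly_Mapping.keys p \<union> Poly_Mapping.keys q"
  by (auto simp: in_keys_iff lookup_minus)

definition polys :: "'v set \<Rightarrow> ('v, 'k::comm_ring_1) mpoly set" where
  "polys V = {p. \<forall>m\<in>Poly_Mapping.keys p. Poly_Mapping.keys m \<subseteq> V}"

lemma mpoly_ring_simps [simp]:
  "carrier (mpoly_ring V) = polys V"
  "x \<otimes>\<^bsub>mpoly_ring V\<^esub> y = x * y" "x \<oplus>\<^bsub>mpoly_ring V\<^esub> y = x + y"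
  "\<one>\<^bsub>mpoly_ring V\<^esub> = 1" "\<zero>\<^bsub>mpoly_ring V\<^esub> = 0"
  by (simp_all add: mpoly_ring_def polys_def)

interpretation S: subring_set "polys V :: ('v, 'k::comm_ring_1) mpoly set" for V
proof
  show "1 \<in> (polys V :: ('v, 'k) mpoly set)" by (simp add: polys_def)
  show "a - b \<in> polys V" if "a \<in> polys V" "b \<in> polys V" for a b :: "('v, 'k) mpoly"
    using that keys_diff_subset[of a b] by (auto simp: polys_def)
  show "a * b \<in> polys V" if "a \<in> polys V" "b \<in> polys V" for a b :: "('v, 'k) mpoly"
  proof -
    interpret cring "mpoly_ring V :: ('v, 'k) mpoly ring" by (rule cring_mpoly_ring)
    show ?thesis using m_closed[of a b] that by simp
  qed
qed

lemma single_in_polys: "Poly_Mapping.keys m \<subseteq> V \<Longrightarrow> Poly_Mapping.single m c \<in> polys V"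
  by (simp add: polys_def)

lemma polys_mono: "A \<subseteq> B \<Longrightarrow> p \<in> polys A \<Longrightarrow> p \<in> polys B"
  unfolding polys_def by blast

lemma Var_in_polys [simp]: "v \<in> V \<Longrightarrow> Var v \<in> polys V"
  by (simp add: polys_def Var_def)

lemma ideal_iff_is_ideal:
  fixes J :: "('v, 'k::comm_ring_1) mpoly set"
  shows "ideal J (mpoly_ring V) \<longleftrightarrow> S.is_ideal V J"
proof
  interpret R: cring "mpoly_ring V :: ('v, 'k) mpoly ring" by (rule cring_mpoly_ring)
  have neg: "\<ominus>\<^bsub>mpoly_ring V\<^esub> a = - a" if "a \<in> polys V" for a :: "('v, 'k) mpoly"
    using that by (intro R.minus_equality) (auto simp: S.uminus_closed)
  show "S.is_ideal V J" if "ideal J (mpoly_ring V)"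
  proof -
    interpret ideal J "mpoly_ring V" by fact
    show ?thesis
      using a_closed additive_subgroup.zero_closed[OF additive_subgroup_axioms] I_l_closed a_subset
      by (auto simp: S.is_ideal_def)
  qed
  show "ideal J (mpoly_ring V)" if J: "S.is_ideal V J"
  proof (rule idealI)
    show "subgroup J (add_monoid (mpoly_ring V))"
    proof (rule R.add.subgroupI)
      show "J \<subseteq> carrier (mpoly_ring V)" "J \<noteq> {}"
        using J by (auto simp: S.is_ideal_def)
    next
      fix a assume "a \<in> J"
      then show "\<ominus>\<^bsub>mpoly_ring V\<^esub> a \<in> J"
        using J S.ideal_sub[OF J] by (simp add: neg S.ideal_uminus)
    next
      fix a b assume "a \<in> J" "b \<in> J"
      then show "a \<oplus>\<^bsub>mpoly_ring V\<^esub> b \<in> J" using J by (simp add: S.ideal_add)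
    qed
  qed (simp_all add: S.ideal_mult[OF J] S.ideal_mult_right[OF J] R.ring_axioms)
qed

lemma ideal_mem_of_monomials:
  assumes "S.is_ideal V J" "p \<in> polys V"
    and "\<And>m. m \<in> Poly_Mapping.keys p \<Longrightarrow> Poly_Mapping.single m 1 \<in> J"
  shows "p \<in> J"
proof -
  have "Poly_Mapping.single m c \<in> J" if "m \<in> Poly_Mapping.keys p" for m c
    using S.ideal_mult[OF assms(1) single_in_polys[of 0] assms(3)[OF that], of c]
    by (simp add: mult_single)
  then show ?thesis
    by (subst mpoly_expand) (auto intro!: S.ideal_sum[OF assms(1)])
qed

definition restr :: "('a \<Rightarrow> bool) \<Rightarrow> ('a \<Rightarrow>\<^sub>0 'b::zero) \<Rightarrow> 'a \<Rightarrow>\<^sub>0 'b" where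
  "restr Q p = Poly_Mapping.mapp (\<lambda>m c. c when Q m) p"

lemma lookup_restr: "Poly_Mapping.lookup (restr Q p) m = (Poly_Mapping.lookup p m when Q m)"
  by (auto simp: restr_def lookup_mapp when_def in_keys_iff)

lemma keys_restr: "Poly_Mapping.keys (restr Q p) = {m \<in> Poly_Mapping.keys p. Q m}"
  by (auto simp: in_keys_iff lookup_restr)

definition expo :: "'v set \<Rightarrow> 'v \<Rightarrow>\<^sub>0 nat" where
  "expo F = (\<Sum>v\<in>F. Poly_Mapping.single v 1)"

lemma lookup_expo: "finite F \<Longrightarrow> Poly_Mapping.lookup (expo F) v = (if v \<in> F then 1 else 0)"
  by (simp add: expo_def lookup_sum lookup_single when_def)

lemma keys_expo: "finite F \<Longrightarrow> Poly_Mapping.keys (expo F) = F"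
  by (auto simp: in_keys_iff lookup_expo split: if_splits)

lemma monom_decomp:
  fixes m :: "'v \<Rightarrow>\<^sub>0 nat"
  assumes "finite F" "F \<subseteq> Poly_Mapping.keys m"
  shows "m = expo F + (m - expo F)"
proof (rule poly_mapping_eqI)
  fix v
  show "Poly_Mapping.lookup m v = Poly_Mapping.lookup (expo F + (m - expo F)) v"
    using assms by (auto simp: lookup_add lookup_minus lookup_expo in_keys_iff subset_iff Suc_leI)
qed

lemma keys_monom_diff:
  fixes m :: "'v \<Rightarrow>\<^sub>0 nat"
  shows "Poly_Mapping.keys (m - a) \<subseteq> Poly_Mapping.keys m"
  by (auto simp: in_keys_iff lookup_minus)

text \<open>If \<open>\<Delta>\<close> is a simplicial complex on \<open>V\<close>, this is its Stanley-Reisner ideal. It is given by its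
  monomials instead of generators, so that colon ideals and sums with a variable become the link and
  deletion of a vertex.\<close>

definition nonface_ideal :: "'v set \<Rightarrow> ('v set \<Rightarrow> bool) \<Rightarrow> ('v, 'k::comm_ring_1) mpoly set" where
  "nonface_ideal V \<Delta> = {p \<in> polys V. \<forall>m\<in>Poly_Mapping.keys p. \<not> \<Delta> (Poly_Mapping.keys m)}"

lemma is_ideal_nonface_ideal:
  assumes "\<And>T U. \<Delta> U \<Longrightarrow> T \<subseteq> U \<Longrightarrow> \<Delta> T"
  shows "S.is_ideal V (nonface_ideal V \<Delta> :: ('v, 'k::comm_ring_1) mpoly set)"
  unfolding S.is_ideal_def
proof (intro conjI ballI)
  fix a b :: "('v, 'k) mpoly" assume "a \<in> nonface_ideal V \<Delta>" "b \<in> nonface_ideal V \<Delta>"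
  then show "a + b \<in> nonface_ideal V \<Delta>"
    using Poly_Mapping.keys_add[of a b] by (auto simp: nonface_ideal_def S.add_closed)
next
  fix r a :: "('v, 'k) mpoly" assume "r \<in> polys V" and a: "a \<in> nonface_ideal V \<Delta>"
  have "\<not> \<Delta> (Poly_Mapping.keys m)" if m_key: "m \<in> Poly_Mapping.keys (r * a)" for m
  proof -
    obtain m1 m2 where m: "m2 \<in> Poly_Mapping.keys a" "m = m1 + m2"
      using subsetD[OF Poly_Mapping.keys_mult m_key] by blast
    then have "\<not> \<Delta> (Poly_Mapping.keys m2)" using a by (simp add: nonface_ideal_def)
    then show ?thesis using assms m by (metis keys_monom_add Un_upper2)
  qed
  then show "r * a \<in> nonface_ideal V \<Delta>"
    using a \<open>r \<in> polys V\<close> by (simp add: nonface_ideal_def S.mult_closed)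
qed (auto simp: nonface_ideal_def S.zero_closed)

lemma keys_mult_single:
  fixes p :: "('v, 'k::comm_ring_1) mpoly"
  shows "Poly_Mapping.keys (Poly_Mapping.single a 1 * p) = (+) a ` Poly_Mapping.keys p"
proof (intro equalityI subsetI)
  fix m assume "m \<in> Poly_Mapping.keys (Poly_Mapping.single a 1 * p)"
  then show "m \<in> (+) a ` Poly_Mapping.keys p"
    using Poly_Mapping.keys_mult[of "Poly_Mapping.single a (1::'k)" p] by auto
next
  fix m assume "m \<in> (+) a ` Poly_Mapping.keys p"
  then show "m \<in> Poly_Mapping.keys (Poly_Mapping.single a 1 * p)"
    by (auto simp: in_keys_iff lookup_single_mult)
qed

lemma monom_factor:
  fixes p :: "('v, 'k::comm_ring_1) mpoly"
  assumes "\<And>m. m \<in> Poly_Mapping.keys p \<Longrightarrow> F \<subseteq> Poly_Mapping.keys m \<and> Poly_Mapping.keys m \<subseteq> A" "finite F"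
  obtains q where "q \<in> polys A" "p = Poly_Mapping.single (expo F) 1 * q"
proof
  define q where "q = (\<Sum>m\<in>Poly_Mapping.keys p. Poly_Mapping.single (m - expo F) (Poly_Mapping.lookup p m))"
  show "q \<in> polys A" unfolding q_def
  proof (intro S.sum_closed single_in_polys)
    fix m assume "m \<in> Poly_Mapping.keys p"
    then show "Poly_Mapping.keys (m - expo F) \<subseteq> A"
      using assms(1) keys_monom_diff[of m "expo F"] by fastforce
  qed
  have "Poly_Mapping.single (expo F) 1 * q =
      (\<Sum>m\<in>Poly_Mapping.keys p. Poly_Mapping.single m (Poly_Mapping.lookup p m))"
    unfolding q_def sum_distrib_left
    using assms monom_decomp[of F, symmetric] by (intro sum.cong) (auto simp: mult_single)
  then show "p = Poly_Mapping.single (expo F) 1 * q" by (simp flip: mpoly_expand)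
qed

lemma colon_nonface_ideal:
  fixes V :: "'v set"
  assumes "v \<in> V"
  shows "S.colon V (nonface_ideal V \<Delta> :: ('v, 'k::comm_ring_1) mpoly set) (Var v) = nonface_ideal V (\<lambda>T. \<Delta> (insert v T))"
proof -
  have "Poly_Mapping.keys (x * Var v) = (+) (Poly_Mapping.single v 1) ` Poly_Mapping.keys x"
    for x :: "('v, 'k) mpoly"
    using keys_mult_single[of "Poly_Mapping.single v 1" x] by (simp add: Var_def mult.commute)
  then show ?thesis using assms
    by (auto simp: S.colon_def nonface_ideal_def keys_monom_add S.mult_closed)
qed

lemma adjoin_nonface_ideal:
  assumes "v \<in> V" "\<And>T U. \<Delta> U \<Longrightarrow> T \<subseteq> U \<Longrightarrow> \<Delta> T"
  shows "S.adjoin V (nonface_ideal V \<Delta>) (Var v) = nonface_ideal V (\<lambda>T. \<Delta> T \<and> v \<notin> T)"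
    (is "?L = ?R")
proof (intro equalityI subsetI)
  have R: "S.is_ideal V ?R" by (rule is_ideal_nonface_ideal) (use assms(2) in blast)
  fix x assume "x \<in> ?L"
  then obtain j r where x: "j \<in> nonface_ideal V \<Delta>" "r \<in> polys V" "x = j + Var v * r"
    by (auto elim: S.adjoinE)
  have "Var v \<in> ?R" using assms(1) by (simp add: nonface_ideal_def) (simp add: Var_def)
  then have "Var v * r \<in> ?R" using S.ideal_mult_right[OF R] x(2) by blast
  moreover have "j \<in> ?R" using x(1) by (auto simp: nonface_ideal_def)
  ultimately show "x \<in> ?R" using S.ideal_add[OF R] x by blast
next
  fix x :: "('a, 'b) mpoly" assume x: "x \<in> ?R"
  let ?a = "restr (\<lambda>m. v \<in> Poly_Mapping.keys m) x" and ?b = "restr (\<lambda>m. v \<notin> Poly_Mapping.keys m) x"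
  have "{v} \<subseteq> Poly_Mapping.keys m \<and> Poly_Mapping.keys m \<subseteq> V" if "m \<in> Poly_Mapping.keys ?a" for m
    using that x by (auto simp: keys_restr nonface_ideal_def polys_def)
  then obtain q where q: "q \<in> polys V" "?a = Poly_Mapping.single (expo {v}) 1 * q"
    by (rule monom_factor) auto
  have "x = ?b + ?a" by (rule poly_mapping_eqI) (simp add: lookup_add lookup_restr when_def)
  then show "x \<in> ?L"
    using q x by (intro S.adjoinI[of ?b _ q])
      (auto simp: nonface_ideal_def keys_restr polys_def Var_def expo_def)
qed

text \<open>The coefficient of \<open>z\<^sup>i\<close> in \<open>p\<close>, seen as a polynomial in \<open>z\<close> over the ring of polynomials in the
  other variables.\<close>

definition var_coeff :: "'v \<Rightarrow> nat \<Rightarrow> ('v, 'k::comm_ring_1) mpoly \<Rightarrow> ('v, 'k) mpoly" where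
  "var_coeff z i p = restr (\<lambda>m. Poly_Mapping.lookup m z = 0)
     (Poly_Mapping.map_key (\<lambda>m. m + Poly_Mapping.single z i) p)"

lemma lookup_var_coeff:
  "Poly_Mapping.lookup (var_coeff z i p) m =
    (Poly_Mapping.lookup p (m + Poly_Mapping.single z i) when Poly_Mapping.lookup m z = 0)"
  by (simp add: var_coeff_def lookup_restr map_key.rep_eq inj_def)

lemma keys_var_coeff:
  "m \<in> Poly_Mapping.keys (var_coeff z i p) \<Longrightarrow> m + Poly_Mapping.single z i \<in> Poly_Mapping.keys p"
  by (simp add: in_keys_iff lookup_var_coeff)

lemma var_coeff_0 [simp]: "var_coeff z i 0 = 0"
  by (rule poly_mapping_eqI) (simp add: lookup_var_coeff)

lemma var_coeff_add: "var_coeff z i (p + q) = var_coeff z i p + var_coeff z i q"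
  by (rule poly_mapping_eqI) (simp add: lookup_var_coeff lookup_add when_def)

lemma var_coeff_single:
  "var_coeff z i (Poly_Mapping.single m c) =
    (if Poly_Mapping.lookup m z = i then Poly_Mapping.single (m - Poly_Mapping.single z i) c else 0)"
proof (rule poly_mapping_eqI)
  fix k
  have "m = k + Poly_Mapping.single z i \<and> Poly_Mapping.lookup k z = 0 \<longleftrightarrow>
      Poly_Mapping.lookup m z = i \<and> m - Poly_Mapping.single z i = k"
    (is "?A \<longleftrightarrow> ?B")
  proof
    assume ?A
    then show ?B by (simp add: lookup_add)
  next
    assume B: ?B
    then have "m = k + Poly_Mapping.single z i"
      by (intro poly_mapping_eqI) (auto simp: lookup_add lookup_minus lookup_single when_def)
    with B show ?A by (simp add: lookup_add)
  qed
  then show "Poly_Mapping.lookup (var_coeff z i (Poly_Mapping.single m c)) k = Poly_Mapping.lookup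
      (if Poly_Mapping.lookup m z = i then Poly_Mapping.single (m - Poly_Mapping.single z i) c else 0) k"
    by (auto simp: lookup_var_coeff lookup_single when_def)
qed

lemma var_coeff_Suc_Var_mult: "var_coeff z (Suc i) (Var z * p) = var_coeff z i p"
proof (rule poly_mapping_eqI)
  fix m
  have "m + Poly_Mapping.single z (Suc i) = Poly_Mapping.single z 1 + (m + Poly_Mapping.single z i)"
    by (simp add: add_ac flip: single_add)
  then show "Poly_Mapping.lookup (var_coeff z (Suc i) (Var z * p)) m = Poly_Mapping.lookup (var_coeff z i p) m"
    using lookup_single_mult[of "Poly_Mapping.single z 1" 1 p] by (simp add: lookup_var_coeff Var_def)
qed

definition free_of :: "'v \<Rightarrow> ('v, 'k::comm_ring_1) mpoly \<Rightarrow> bool" where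
  "free_of z p \<longleftrightarrow> (\<forall>m\<in>Poly_Mapping.keys p. z \<notin> Poly_Mapping.keys m)"

lemma var_coeff_free_of_mult:
  assumes "free_of z q"
  shows "var_coeff z i (q * p) = q * var_coeff z i p"
proof -
  have *: "var_coeff z i (Poly_Mapping.single m c * p) = Poly_Mapping.single m c * var_coeff z i p"
    if "z \<notin> Poly_Mapping.keys m" for m c and p :: "('a, 'b) mpoly"
  proof (induction p rule: mpoly_induct)
    case (single k d)
    have "m + k - Poly_Mapping.single z (Poly_Mapping.lookup k z) =
        m + (k - Poly_Mapping.single z (Poly_Mapping.lookup k z))"
      by (rule poly_mapping_eqI) (auto simp: lookup_add lookup_minus lookup_single when_def)
    then show ?case
      using that by (auto simp: mult_single var_coeff_single lookup_add in_keys_iff)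
  qed (simp_all add: distrib_left var_coeff_add)
  show ?thesis
  proof (induction q rule: mpoly_induct)
    case (single m c)
    then show ?case using * assms by (simp add: free_of_def)
  qed (simp_all add: distrib_right var_coeff_add)
qed

lemma var_coeff_in_polys: "p \<in> polys V \<Longrightarrow> var_coeff z i p \<in> polys V"
  by (fastforce simp: polys_def keys_monom_add dest: keys_var_coeff)

lemma sum_var_coeff:
  obtains d where "\<And>i. i > d \<Longrightarrow> var_coeff z i p = 0"
    "p = (\<Sum>i\<le>d. Poly_Mapping.single (Poly_Mapping.single z i) 1 * var_coeff z i p)"
proof -
  let ?P = "\<lambda>d p. (\<forall>i>d. var_coeff z i p = 0) \<and>
    (\<Sum>i\<le>d. Poly_Mapping.single (Poly_Mapping.single z i) 1 * var_coeff z i p) = p"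
  have mono: "?P (max d e) p" if "?P d p" for d e and p :: "('a, 'b) mpoly"
  proof -
    have "(\<Sum>i\<le>d. Poly_Mapping.single (Poly_Mapping.single z i) 1 * var_coeff z i p) =
        (\<Sum>i\<le>max d e. Poly_Mapping.single (Poly_Mapping.single z i) 1 * var_coeff z i p)"
      by (rule sum.mono_neutral_left) (use that in auto)
    then show ?thesis using that by auto
  qed
  have "\<exists>d. ?P d p"
  proof (induction p rule: mpoly_induct)
    case (single m c)
    have "m = Poly_Mapping.single z (Poly_Mapping.lookup m z) +
        (m - Poly_Mapping.single z (Poly_Mapping.lookup m z))"
      by (rule poly_mapping_eqI) (auto simp: lookup_add lookup_minus lookup_single when_def)
    then have "Poly_Mapping.single (Poly_Mapping.single z i) 1 * var_coeff z i (Poly_Mapping.single m c) =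
        (if i = Poly_Mapping.lookup m z then Poly_Mapping.single m c else 0)" for i
      by (simp add: var_coeff_single mult_single)
    then show ?case
      by (intro exI[of _ "Poly_Mapping.lookup m z"]) (simp add: var_coeff_single)
  next
    case (add a b)
    then obtain d e where de: "?P d a" "?P e b" by blast
    define M where "M = max d e"
    have M: "?P M a" "?P M b"
      using mono[OF de(1), of e] mono[OF de(2), of d] unfolding M_def max.commute[of e d] by blast+
    have "?P M (a + b)"
    proof (intro conjI allI impI)
      fix i assume "i > M"
      then show "var_coeff z i (a + b) = 0" using M by (simp only: var_coeff_add) simp
    next
      show "(\<Sum>i\<le>M. Poly_Mapping.single (Poly_Mapping.single z i) 1 * var_coeff z i (a + b)) = a + b"
        using M by (simp only: var_coeff_add distrib_left sum.distrib)
    qed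
    then show ?case by blast
  qed simp
  then obtain d where d: "\<forall>i>d. var_coeff z i p = 0"
      "(\<Sum>i\<le>d. Poly_Mapping.single (Poly_Mapping.single z i) 1 * var_coeff z i p) = p" by blast
  show thesis by (rule that[OF _ d(2)[symmetric]]) (use d(1) in blast)
qed

text \<open>As \<open>J\<close> contains the coefficients of its members, \<open>S/J\<close> is a polynomial ring in \<open>z\<close> over another
  ring, and \<open>z + q\<close> is monic in \<open>z\<close>. The coefficients \<open>c\<^sub>i\<close> of \<open>x\<close> satisfy
  \<open>c\<^sub>i + q c\<^sub>i\<^sub>+\<^sub>1 \<in> J\<close>, so they lie in \<open>J\<close> by descending induction from the degree of \<open>x\<close>.\<close>

lemma nzd_Var_add_free_of:
  assumes J: "S.is_ideal V J" and zJ: "\<And>i p. p \<in> J \<Longrightarrow> var_coeff z i p \<in> J"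
    and "z \<in> V" "q \<in> polys V" "free_of z q"
  shows "S.nzd V (Var z + q) J"
  unfolding S.nzd_def
proof (intro ballI impI)
  fix x assume x: "x \<in> polys V" "(Var z + q) * x \<in> J"
  obtain d where d: "\<And>i. i > d \<Longrightarrow> var_coeff z i x = 0"
      "x = (\<Sum>i\<le>d. Poly_Mapping.single (Poly_Mapping.single z i) 1 * var_coeff z i x)"
    using sum_var_coeff[of z x] by blast
  have "var_coeff z i x \<in> J" if "i \<le> Suc d" for i
    using that
  proof (induction i rule: inc_induct)
    case base
    then show ?case using d S.ideal_zero[OF J] by simp
  next
    case (step i)
    have "var_coeff z i x = var_coeff z (Suc i) ((Var z + q) * x) - q * var_coeff z (Suc i) x"
      using assms(5) by (simp add: distrib_right var_coeff_add var_coeff_Suc_Var_mult var_coeff_free_of_mult)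
    then show ?case
      using zJ[OF x(2)] step assms(4) by (simp add: S.ideal_diff[OF J] S.ideal_mult[OF J])
  qed
  then show "x \<in> J"
    by (subst d(2)) (use \<open>z \<in> V\<close> in \<open>auto intro!: S.ideal_sum[OF J] S.ideal_mult[OF J] single_in_polys split: if_splits\<close>)
qed

text \<open>Each \<open>\<theta> a\<close> has a private variable \<open>z a\<close>, which occurs in no other \<open>\<theta> b\<close>. Hence adjoining
  \<open>\<theta> a\<close> to \<open>J\<close> does not destroy the hypothesis of the preceding lemma for the other variables.\<close>

lemma weakly_regular_Var_add_free_of:
  assumes "S.is_ideal V J" "distinct as"
    and "\<And>a. a \<in> set as \<Longrightarrow> z a \<in> V \<and> \<theta> a \<in> polys V \<and> free_of (z a) (\<theta> a - Var (z a))"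
    and "\<And>a b. a \<in> set as \<Longrightarrow> b \<in> set as \<Longrightarrow> a \<noteq> b \<Longrightarrow> free_of (z a) (\<theta> b)"
    and "\<And>a p i. a \<in> set as \<Longrightarrow> p \<in> J \<Longrightarrow> var_coeff (z a) i p \<in> J"
  shows "S.weakly_regular V J (map \<theta> as)"
  using assms
proof (induction as arbitrary: J)
  case (Cons a as)
  have "S.nzd V (Var (z a) + (\<theta> a - Var (z a))) J"
    using Cons.prems by (intro nzd_Var_add_free_of) (auto intro: S.diff_closed)
  moreover have "S.weakly_regular V (S.adjoin V J (\<theta> a)) (map \<theta> as)"
  proof (rule Cons.IH)
    fix b p i assume b: "b \<in> set as" and "p \<in> S.adjoin V J (\<theta> a)"
    then obtain j r where "j \<in> J" "r \<in> polys V" "p = j + \<theta> a * r" by (auto elim: S.adjoinE)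
    moreover have "free_of (z b) (\<theta> a)" using Cons.prems b by auto
    ultimately show "var_coeff (z b) i p \<in> S.adjoin V J (\<theta> a)"
      using b Cons.prems(5)
      by (intro S.adjoinI[of "var_coeff (z b) i j" _ "var_coeff (z b) i r"])
        (auto simp: var_coeff_add var_coeff_free_of_mult var_coeff_in_polys)
  qed (use Cons.prems in \<open>auto intro!: S.is_ideal_adjoin\<close>)
  ultimately show ?case by simp
qed simp

section \<open>Star forms of a packing\<close>

locale fin_graph =
  fixes G :: "'v sgraph"
  assumes finite_verts: "finite (verts G)"
    and edge_verts: "{u, v} \<in> edges G \<Longrightarrow> u \<in> verts G \<and> u \<noteq> v"
begin

definition nbhd :: "'v \<Rightarrow> 'v set" where
  "nbhd v = {u. {u, v} \<in> edges G}"

definition indep :: "'v set \<Rightarrow> bool" where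
  "indep T \<longleftrightarrow> (\<forall>v\<in>T. nbhd v \<inter> T = {})"

definition packing :: "'v set \<Rightarrow> bool" where
  "packing A \<longleftrightarrow> A \<subseteq> verts G \<and>
    (\<forall>a\<in>A. \<forall>b\<in>A. a \<noteq> b \<longrightarrow> insert a (nbhd a) \<inter> insert b (nbhd b) = {})"

definition dominating :: "'v set \<Rightarrow> bool" where
  "dominating D \<longleftrightarrow> D \<subseteq> verts G \<and> (\<forall>v \<in> verts G - D. nbhd v \<inter> D \<noteq> {})"

lemma nbhd_sym: "u \<in> nbhd v \<longleftrightarrow> v \<in> nbhd u"
  by (simp add: nbhd_def insert_commute)

lemma nbhd_verts: "u \<in> nbhd v \<Longrightarrow> u \<in> verts G"
  by (auto simp: nbhd_def dest: edge_verts)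

lemma nbhd_irrefl: "v \<notin> nbhd v"
  using edge_verts[of v v] by (auto simp: nbhd_def)

lemma finite_nbhd: "finite (nbhd v)"
  using finite_verts by (rule rev_finite_subset) (auto dest: nbhd_verts)

lemma indep_mono: "indep U \<Longrightarrow> T \<subseteq> U \<Longrightarrow> indep T"
  unfolding indep_def by blast

lemma indep_empty: "indep {}"
  by (simp add: indep_def)

lemma indep_insert: "indep (insert v T) \<longleftrightarrow> indep T \<and> nbhd v \<inter> T = {}"
  unfolding indep_def using nbhd_sym nbhd_irrefl by blast

lemma edge_ideal_eq:
  "edge_ideal G = (nonface_ideal (verts G) indep :: ('v, 'k::comm_ring_1) mpoly set)" (is "?L = ?R")
proof
  have "ideal ?R (mpoly_ring (verts G))"
    unfolding ideal_iff_is_ideal by (rule is_ideal_nonface_ideal) (rule indep_mono)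
  moreover have "Var u * Var v \<in> ?R" if "{u, v} \<in> edges G" for u v
  proof -
    have uv: "u \<in> nbhd v" using that by (simp add: nbhd_def)
    have "u \<in> verts G" "v \<in> verts G" using uv nbhd_sym[of u v] by (blast dest: nbhd_verts)+
    moreover have "\<not> indep (insert v {u})" using uv by (simp add: indep_insert)
    ultimately show ?thesis
      by (simp add: nonface_ideal_def S.mult_closed)
        (simp add: Var_def mult_single keys_monom_add insert_commute)
  qed
  ultimately show "?L \<subseteq> ?R" unfolding edge_ideal_def genideal_def by blast
next
  show "?R \<subseteq> ?L"
  proof
    fix p :: "('v, 'k) mpoly" assume p: "p \<in> ?R"
    show "p \<in> ?L" unfolding edge_ideal_def genideal_def
    proof safe
      fix J :: "('v, 'k) mpoly set" assume "ideal J (mpoly_ring (verts G))"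
        and gen: "{Var u * Var v |u v. {u, v} \<in> edges G} \<subseteq> J"
      then have J: "S.is_ideal (verts G) J" by (simp add: ideal_iff_is_ideal)
      show "p \<in> J"
      proof (rule ideal_mem_of_monomials[OF J])
        fix m assume "m \<in> Poly_Mapping.keys p"
        then have m: "\<not> indep (Poly_Mapping.keys m)" "Poly_Mapping.keys m \<subseteq> verts G"
          using p by (auto simp: nonface_ideal_def polys_def)
        then obtain u v where uv: "u \<in> Poly_Mapping.keys m" "v \<in> Poly_Mapping.keys m" "u \<in> nbhd v"
          by (auto simp: indep_def)
        have "u \<noteq> v" using uv nbhd_irrefl by blast
        have "m = expo {u, v} + (m - expo {u, v})" by (rule monom_decomp) (use uv in auto)
        moreover have "Poly_Mapping.single (expo {u, v}) 1 = (Var u * Var v :: ('v, 'k) mpoly)"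
          using \<open>u \<noteq> v\<close> by (simp add: expo_def Var_def mult_single)
        ultimately have "Poly_Mapping.single m 1 =
            Var u * Var v * (Poly_Mapping.single (m - expo {u, v}) 1 :: ('v, 'k) mpoly)"
          by (metis mult_single mult_1)
        moreover have "Var u * Var v \<in> J" using gen uv by (auto simp: nbhd_def)
        moreover have "Poly_Mapping.single (m - expo {u, v}) (1::'k) \<in> polys (verts G)"
          using m keys_monom_diff[of m] by (intro single_in_polys) blast
        ultimately show "Poly_Mapping.single m 1 \<in> J" by (simp add: S.ideal_mult_right[OF J])
      qed (use p in \<open>simp add: nonface_ideal_def\<close>)
    qed
  qed
qed

lemma is_ideal_edge_ideal: "S.is_ideal (verts G) (edge_ideal G)"
  unfolding edge_ideal_eq by (rule is_ideal_nonface_ideal) (rule indep_mono)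

definition star_form :: "'v \<Rightarrow> ('v, 'k::comm_ring_1) mpoly" where
  "star_form a = (\<Sum>v\<in>insert a (nbhd a). Var v)"

lemma free_of_sum_Var: "z \<notin> T \<Longrightarrow> free_of z (\<Sum>v\<in>T. Var v :: ('a, 'k::comm_ring_1) mpoly)"
proof -
  assume "z \<notin> T"
  have "Poly_Mapping.keys m \<subseteq> T" if "m \<in> Poly_Mapping.keys (\<Sum>v\<in>T. Var v :: ('a, 'k) mpoly)" for m
    using subsetD[OF Poly_Mapping.keys_sum that] by (auto simp: Var_def split: if_splits)
  then show ?thesis using \<open>z \<notin> T\<close> by (auto simp: free_of_def)
qed

text \<open>The quotient considered here is the edge ring of the subgraph induced on \<open>U\<close>. The invariant asks that
  \<open>a\<close> is still present or that one of its neighbours survives as an isolated vertex. While some \<open>a\<close>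
  has no isolated vertex in its closed neighbourhood, split at a neighbour \<open>y\<close> of \<open>a\<close>: the colon ideal
  removes the neighbours of \<open>y\<close>, which makes \<open>y\<close> isolated, and the sum removes \<open>y\<close>. Because the closed
  neighbourhoods are disjoint, neither affects the invariant at the other members of the packing.\<close>

lemma weakly_regular_star_forms_induced:
  assumes A: "packing (set as)" "distinct as" and "U \<subseteq> verts G"
    and "\<And>a. a \<in> set as \<Longrightarrow> a \<in> U \<or> (\<exists>z\<in>nbhd a \<inter> U. nbhd z \<inter> U = {})"
  shows "S.weakly_regular (verts G)
    (nonface_ideal (verts G) (\<lambda>T. T \<subseteq> U \<and> indep T) :: ('v, 'k::comm_ring_1) mpoly set)
    (map star_form as)"
  using finite_subset[OF \<open>U \<subseteq> verts G\<close> finite_verts] assms(3,4)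
proof (induction U rule: finite_psubset_induct)
  case (psubset U)
  let ?V = "verts G" and ?J = "\<lambda>U. nonface_ideal (verts G) (\<lambda>T. T \<subseteq> U \<and> indep T) :: ('v, 'k) mpoly set"
  have disj: "insert a (nbhd a) \<inter> insert b (nbhd b) = {}" if "a \<in> set as" "b \<in> set as" "a \<noteq> b" for a b
    using A that by (auto simp: packing_def)
  have star: "star_form a \<in> (polys ?V :: ('v, 'k) mpoly set)" if "a \<in> set as" for a
    using that A nbhd_verts by (auto simp: star_form_def packing_def intro!: S.sum_closed)
  have mono: "T \<subseteq> U \<and> indep T" if "S \<subseteq> U \<and> indep S" "T \<subseteq> S" for S T
    using that indep_mono by blast
  have J: "S.is_ideal ?V (?J U)" by (rule is_ideal_nonface_ideal) (rule mono)
  show ?case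
  proof (cases "\<forall>a\<in>set as. \<exists>z\<in>insert a (nbhd a) \<inter> U. nbhd z \<inter> U = {}")
    case True
    then obtain z where z: "\<And>a. a \<in> set as \<Longrightarrow> z a \<in> insert a (nbhd a) \<inter> U \<and> nbhd (z a) \<inter> U = {}"
      by metis
    show ?thesis
    proof (rule weakly_regular_Var_add_free_of[OF J \<open>distinct as\<close>])
      fix a assume a: "a \<in> set as"
      have eq: "star_form a - Var (z a) = (\<Sum>v\<in>insert a (nbhd a) - {z a}. Var v :: ('v, 'k) mpoly)"
        using z[OF a] finite_nbhd[of a] by (simp add: star_form_def sum_diff1 del: sum.insert)
      have "free_of (z a) (star_form a - Var (z a) :: ('v, 'k) mpoly)"
        unfolding eq by (rule free_of_sum_Var) simp
      then show "z a \<in> ?V \<and> star_form a \<in> (polys ?V :: ('v, 'k) mpoly set) \<and>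
          free_of (z a) (star_form a - Var (z a) :: ('v, 'k) mpoly)"
        using star[OF a] z[OF a] psubset.prems(1) by auto
    next
      fix a b assume "a \<in> set as" "b \<in> set as" "a \<noteq> b"
      then show "free_of (z a) (star_form b :: ('v, 'k) mpoly)"
        using disj z unfolding star_form_def by (intro free_of_sum_Var) blast
    next
      fix a i and p :: "('v, 'k) mpoly" assume a: "a \<in> set as" and p: "p \<in> ?J U"
      have "\<not> (Poly_Mapping.keys m \<subseteq> U \<and> indep (Poly_Mapping.keys m))"
        if "m \<in> Poly_Mapping.keys (var_coeff (z a) i p)" for m
      proof
        let ?m = "m + Poly_Mapping.single (z a) i"
        assume "Poly_Mapping.keys m \<subseteq> U \<and> indep (Poly_Mapping.keys m)"
        then have "insert (z a) (Poly_Mapping.keys m) \<subseteq> U \<and> indep (insert (z a) (Poly_Mapping.keys m))"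
          using z[OF a] by (auto simp: indep_insert)
        then have "Poly_Mapping.keys ?m \<subseteq> U \<and> indep (Poly_Mapping.keys ?m)"
          by (rule mono) (auto simp: keys_monom_add split: if_splits)
        then show False using p keys_var_coeff[OF that] unfolding nonface_ideal_def by blast
      qed
      then show "var_coeff (z a) i p \<in> ?J U"
        using p by (simp add: nonface_ideal_def var_coeff_in_polys)
    qed
  next
    case False
    then obtain a where a: "a \<in> set as" "\<And>z. z \<in> insert a (nbhd a) \<inter> U \<Longrightarrow> nbhd z \<inter> U \<noteq> {}" by blast
    then have "a \<in> U" using psubset.prems(2)[OF a(1)] by blast
    then obtain y where y: "y \<in> nbhd a" "y \<in> U" using a(2)[of a] by blast
    have ay: "a \<in> nbhd y" using y nbhd_sym by blast
    have not_nbhd: "b \<notin> nbhd y" "b \<noteq> y" if "b \<in> set as" "b \<noteq> a" for b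
      using disj[OF that(1) a(1) that(2)] y nbhd_sym[of b y] by blast+
    have "S.colon ?V (?J U) (Var y) = ?J (U - nbhd y)"
    proof -
      have "insert y T \<subseteq> U \<and> indep (insert y T) \<longleftrightarrow> T \<subseteq> U - nbhd y \<and> indep T" for T
        using y by (auto simp: indep_insert)
      then show ?thesis using y psubset.prems(1) by (subst colon_nonface_ideal) auto
    qed
    moreover have "S.weakly_regular ?V (?J (U - nbhd y)) (map star_form as)"
    proof (rule psubset.IH)
      fix b assume b: "b \<in> set as"
      show "b \<in> U - nbhd y \<or> (\<exists>z\<in>nbhd b \<inter> (U - nbhd y). nbhd z \<inter> (U - nbhd y) = {})"
      proof (cases "b = a")
        case True
        then show ?thesis using y nbhd_irrefl[of y] by blast
      next
        case False
        consider "b \<in> U" | z where "z \<in> nbhd b \<inter> U" "nbhd z \<inter> U = {}"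
          using psubset.prems(2)[OF b] by blast
        then show ?thesis using not_nbhd[OF b False] y nbhd_sym by cases blast+
      qed
    qed (use psubset.prems(1) ay \<open>a \<in> U\<close> in auto)
    moreover have "S.adjoin ?V (?J U) (Var y) = ?J (U - {y})"
    proof -
      have "S.adjoin ?V (?J U) (Var y) =
          nonface_ideal ?V (\<lambda>T. (T \<subseteq> U \<and> indep T) \<and> y \<notin> T)"
        by (rule adjoin_nonface_ideal) (use y psubset.prems(1) in blast, rule mono)
      moreover have "(\<lambda>T. (T \<subseteq> U \<and> indep T) \<and> y \<notin> T) = (\<lambda>T. T \<subseteq> U - {y} \<and> indep T)" by blast
      ultimately show ?thesis by simp
    qed
    moreover have "S.weakly_regular ?V (?J (U - {y})) (map star_form as)"
    proof (rule psubset.IH)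
      fix b assume b: "b \<in> set as"
      have "b \<noteq> y" using not_nbhd(2)[OF b] y nbhd_irrefl by blast
      consider "b \<in> U" | z where "z \<in> nbhd b \<inter> U" "nbhd z \<inter> U = {}"
        using psubset.prems(2)[OF b] by blast
      then show "b \<in> U - {y} \<or> (\<exists>z\<in>nbhd b \<inter> (U - {y}). nbhd z \<inter> (U - {y}) = {})"
        using \<open>b \<noteq> y\<close> ay \<open>a \<in> U\<close> by cases blast+
    qed (use psubset.prems(1) y in auto)
    ultimately show ?thesis
      using y psubset.prems(1) star
      by (intro S.weakly_regular_split[OF J, of "Var y"]) auto
  qed
qed

lemma weakly_regular_star_forms:
  assumes "packing (set as)" "distinct as"
  shows "S.weakly_regular (verts G) (edge_ideal G :: ('v, 'k::comm_ring_1) mpoly set)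
    (map star_form as)"
proof -
  have "edge_ideal G = (nonface_ideal (verts G) (\<lambda>T. T \<subseteq> verts G \<and> indep T) :: ('v, 'k) mpoly set)"
    unfolding edge_ideal_eq by (auto simp: nonface_ideal_def polys_def)
  then show ?thesis
    using weakly_regular_star_forms_induced[OF assms, of "verts G"] assms by (simp add: packing_def subset_iff)
qed

end

section \<open>Algebraic relations\<close>

definition exp_bound :: "nat \<Rightarrow> ('v, 'k::comm_ring_1) mpoly \<Rightarrow> bool" where
  "exp_bound e p \<longleftrightarrow> (\<forall>m\<in>Poly_Mapping.keys p. \<forall>v. Poly_Mapping.lookup m v \<le> e)"

lemma exp_bound_one: "exp_bound 0 1"
  by (simp add: exp_bound_def)

lemma exp_bound_mult:
  fixes p q :: "('v, 'k::comm_ring_1) mpoly"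
  assumes "exp_bound d p" "exp_bound e q"
  shows "exp_bound (d + e) (p * q)"
  unfolding exp_bound_def
proof (intro ballI allI)
  fix m v assume "m \<in> Poly_Mapping.keys (p * q)"
  then obtain a b where "a \<in> Poly_Mapping.keys p" "b \<in> Poly_Mapping.keys q" "m = a + b"
    using subsetD[OF Poly_Mapping.keys_mult] by fastforce
  then show "Poly_Mapping.lookup m v \<le> d + e"
    using assms by (simp add: exp_bound_def lookup_add add_mono)
qed

lemma exp_bound_power: "exp_bound e p \<Longrightarrow> exp_bound (e * n) (p ^ n)"
  by (induction n) (simp_all add: exp_bound_one exp_bound_mult)

lemma exp_bound_prod:
  "(\<And>i. i < r \<Longrightarrow> exp_bound e (f i)) \<Longrightarrow> exp_bound (e * r) (\<Prod>i<(r::nat). f i)"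
proof (induction r)
  case (Suc r)
  then show ?case using exp_bound_mult[of "e * r" "\<Prod>i<r. f i" e "f r"] by (simp add: add.commute)
qed (simp add: exp_bound_one)

lemma exp_bound_exists:
  fixes p :: "('v, 'k::comm_ring_1) mpoly"
  obtains e where "exp_bound e p"
proof -
  have "Poly_Mapping.lookup m v \<le> (\<Sum>m\<in>Poly_Mapping.keys p. \<Sum>v\<in>Poly_Mapping.keys m. Poly_Mapping.lookup m v)"
    if m: "m \<in> Poly_Mapping.keys p" for m v
  proof (cases "v \<in> Poly_Mapping.keys m")
    case True
    then have "Poly_Mapping.lookup m v \<le> (\<Sum>v\<in>Poly_Mapping.keys m. Poly_Mapping.lookup m v)"
      by (intro member_le_sum) auto
    also have "\<dots> \<le> (\<Sum>m\<in>Poly_Mapping.keys p. \<Sum>v\<in>Poly_Mapping.keys m. Poly_Mapping.lookup m v)"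
      using m by (intro member_le_sum[where f = "\<lambda>m. \<Sum>v\<in>Poly_Mapping.keys m. Poly_Mapping.lookup m v"]) auto
    finally show ?thesis .
  qed (simp add: in_keys_iff)
  then show thesis using that unfolding exp_bound_def by blast
qed

lemma exp_bound_mono: "exp_bound d p \<Longrightarrow> d \<le> e \<Longrightarrow> exp_bound e p"
  unfolding exp_bound_def using order_trans by blast

lemma exp_bound_list:
  obtains e where "\<And>p. p \<in> set ps \<Longrightarrow> exp_bound e p"
proof -
  have "\<exists>e. \<forall>p\<in>set ps. exp_bound e p"
  proof (induction ps)
    case (Cons p ps)
    then obtain e where e: "\<forall>p\<in>set ps. exp_bound e p" by blast
    obtain d where "exp_bound d p" by (rule exp_bound_exists)
    then show ?case
      using e by (intro exI[of _ "max d e"]) (auto intro: exp_bound_mono)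
  qed simp
  then show thesis using that by blast
qed

definition bounded_monoms :: "'v set \<Rightarrow> nat \<Rightarrow> ('v \<Rightarrow>\<^sub>0 nat) set" where
  "bounded_monoms D e = {m. Poly_Mapping.keys m \<subseteq> D \<and> (\<forall>v. Poly_Mapping.lookup m v \<le> e)}"

lemma card_bounded_monoms:
  assumes "finite D"
  shows "finite (bounded_monoms D e)" "card (bounded_monoms D e) \<le> Suc e ^ card D"
proof -
  let ?f = "\<lambda>m. restrict (Poly_Mapping.lookup m) D"
  have inj: "inj_on ?f (bounded_monoms D e)"
  proof (rule inj_onI)
    fix m m' assume m: "m \<in> bounded_monoms D e" "m' \<in> bounded_monoms D e" "?f m = ?f m'"
    show "m = m'"
    proof (rule poly_mapping_eqI)
      fix v
      show "Poly_Mapping.lookup m v = Poly_Mapping.lookup m' v"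
        using fun_cong[OF m(3), of v] m(1,2)
        by (cases "v \<in> D") (auto simp: bounded_monoms_def subset_iff in_keys_iff, metis gr0I)
    qed
  qed
  have sub: "?f ` bounded_monoms D e \<subseteq> D \<rightarrow>\<^sub>E {..e}"
    by (auto simp: bounded_monoms_def)
  have fin: "finite (D \<rightarrow>\<^sub>E {..e})" using assms by (simp add: finite_PiE)
  show "finite (bounded_monoms D e)"
    using inj sub fin by (metis finite_imageD finite_subset)
  have "card (bounded_monoms D e) \<le> card (D \<rightarrow>\<^sub>E {..e})"
    by (rule card_inj_on_le[OF inj sub fin])
  then show "card (bounded_monoms D e) \<le> Suc e ^ card D"
    using assms by (simp add: card_PiE)
qed

interpretation mpoly: vector_space "\<lambda>c p. Poly_Mapping.single 0 c * p :: ('v, 'k::field) mpoly"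
  by unfold_locales (simp_all add: algebra_simps single_add mult_single flip: mult.assoc)

lemma linear_relation:
  fixes g :: "'b \<Rightarrow> ('v, 'k::field) mpoly"
  assumes "finite E" "finite B" "card B < card E" "\<And>b. b \<in> E \<Longrightarrow> Poly_Mapping.keys (g b) \<subseteq> B"
  obtains E' c where "E' \<subseteq> E" "E' \<noteq> {}" "\<And>b. b \<in> E' \<Longrightarrow> c b \<noteq> 0"
    "(\<Sum>b\<in>E'. Poly_Mapping.single 0 (c b) * g b) = 0"
proof (cases "inj_on g E")
  case False
  then obtain x y where xy: "x \<in> E" "y \<in> E" "x \<noteq> y" "g x = g y" by (auto simp: inj_on_def)
  show thesis
  proof (rule that)
    show "(\<Sum>b\<in>{x, y}. Poly_Mapping.single 0 (if b = x then 1 else - 1) * g b) = 0"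
      using xy by (simp add: single_uminus)
  qed (use xy in auto)
next
  case True
  let ?mon = "(\<lambda>m. Poly_Mapping.single m 1) ` B :: ('v, 'k) mpoly set"
  have "p \<in> mpoly.span ?mon" if "Poly_Mapping.keys p \<subseteq> B" for p :: "('v, 'k) mpoly"
  proof -
    have "Poly_Mapping.single m (Poly_Mapping.lookup p m) \<in> mpoly.span ?mon" if "m \<in> B" for m
    proof -
      have "Poly_Mapping.single m 1 \<in> mpoly.span ?mon" using that by (intro mpoly.span_base) blast
      from mpoly.span_scale[OF this, of "Poly_Mapping.lookup p m"]
      show ?thesis by (simp add: mult_single)
    qed
    then show ?thesis
      using \<open>Poly_Mapping.keys p \<subseteq> B\<close> by (subst mpoly_expand) (intro mpoly.span_sum, blast)
  qed
  then have "g ` E \<subseteq> mpoly.span ?mon" using assms(4) by blast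
  moreover have "card ?mon < card (g ` E)"
    using card_image_le[OF \<open>finite B\<close>] assms(3) card_image[OF True] by (metis le_less_trans)
  ultimately have "mpoly.dependent (g ` E)"
    using mpoly.independent_span_bound[of ?mon "g ` E"] \<open>finite B\<close> by (meson finite_imageI leD)
  then obtain T u where T: "finite T" "T \<subseteq> g ` E" "\<exists>v\<in>T. u v \<noteq> 0"
      "(\<Sum>v\<in>T. Poly_Mapping.single 0 (u v) * v) = 0"
    unfolding mpoly.dependent_explicit by blast
  \<comment> \<open>The linear dependence is one between the values of \<open>g\<close>; injectivity turns it into one between indices.\<close>
  let ?E = "{b \<in> E. g b \<in> T \<and> u (g b) \<noteq> 0}"
  show thesis
  proof (rule that)
    have "(\<Sum>b\<in>?E. Poly_Mapping.single 0 (u (g b)) * g b) =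
        (\<Sum>v\<in>g ` ?E. Poly_Mapping.single 0 (u v) * v)"
      using True by (subst sum.reindex) (auto simp: inj_on_def)
    also have "\<dots> = (\<Sum>v\<in>T. Poly_Mapping.single 0 (u v) * v)"
      by (rule sum.mono_neutral_left) (use T in auto)
    finally show "(\<Sum>b\<in>?E. Poly_Mapping.single 0 (u (g b)) * g b) = 0" using T by simp
  qed (use T in auto)
qed

text \<open>More than \<open>|D|\<close> polynomials are algebraically dependent modulo the variables outside \<open>D\<close>. There are
  \<open>t\<^sup>r\<close> products of the \<open>r\<close> polynomials with exponents below \<open>t\<close>, but if \<open>L\<close> bounds the exponents in
  the polynomials, only \<open>(L r t + 1)\<^bsup>|D|\<^esup>\<close> monomials in \<open>D\<close> can occur in these products. For \<open>r > |D|\<close>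
  and large \<open>t\<close> the products outnumber the monomials.\<close>

lemma algebraic_relation:
  fixes fs :: "('v, 'k::field) mpoly list"
  assumes "finite D" "card D < length fs"
  obtains E c where "finite E" "E \<noteq> {}" "\<And>b. b \<in> E \<Longrightarrow> length b = length fs" "\<And>b. b \<in> E \<Longrightarrow> c b \<noteq> 0"
    "\<And>m. Poly_Mapping.keys m \<subseteq> D \<Longrightarrow> Poly_Mapping.lookup
      (\<Sum>b\<in>E. Poly_Mapping.single 0 (c b) * (\<Prod>i<length fs. fs ! i ^ (b ! i))) m = 0"
proof -
  define r where "r = length fs"
  obtain L where L: "\<And>p. p \<in> set fs \<Longrightarrow> exp_bound L p"
    using exp_bound_list[of fs] by blast
  \<comment> \<open>Large enough for \<open>(L r t + 1)\<^bsup>|D|\<^esup> \<le> (L r + 1)\<^bsup>|D|\<^esup> t\<^bsup>|D|\<^esup> < t\<^bsup>|D| + 1\<^esup> \<le> t\<^sup>r\<close>.\<close>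
  define t where "t = Suc (Suc (L * r) ^ card D)"
  define h where "h b = (\<Prod>i<r. fs ! i ^ (b ! i))" for b :: "nat list"
  define g where "g b = restr (\<lambda>m. Poly_Mapping.keys m \<subseteq> D) (h b)" for b
  define E where "E = {b :: nat list. set b \<subseteq> {..<t} \<and> length b = r}"
  have cE: "finite E" "card E = t ^ r"
    by (simp_all add: E_def finite_lists_length_eq card_lists_length_eq)
  have "exp_bound (L * t * r) (h b)" if "b \<in> E" for b
  proof -
    have "exp_bound (L * t) (fs ! i ^ (b ! i))" if "i < r" for i
    proof -
      have "b ! i \<in> {..<t}" using \<open>b \<in> E\<close> \<open>i < r\<close> nth_mem[of i b] unfolding E_def by blast
      then have "b ! i \<le> t" by simp
      then show ?thesis
        using exp_bound_power[OF L, of "fs ! i" "b ! i"] \<open>i < r\<close>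
        by (auto simp: r_def intro: exp_bound_mono)
    qed
    then show ?thesis unfolding h_def by (rule exp_bound_prod)
  qed
  then have keys: "Poly_Mapping.keys (g b) \<subseteq> bounded_monoms D (L * t * r)" if "b \<in> E" for b
    using that by (auto simp: g_def keys_restr bounded_monoms_def exp_bound_def)
  have "card (bounded_monoms D (L * t * r)) \<le> Suc (L * t * r) ^ card D"
    by (rule card_bounded_monoms) fact
  also have "\<dots> \<le> (t * Suc (L * r)) ^ card D"
    by (rule power_mono) (auto simp: t_def algebra_simps)
  also have "\<dots> = t ^ card D * Suc (L * r) ^ card D" by (rule power_mult_distrib)
  also have "\<dots> < t ^ card D * t" by (simp add: t_def del: power_Suc mult_Suc)
  also have "\<dots> = t ^ Suc (card D)" by (simp add: mult.commute)
  also have "\<dots> \<le> t ^ r"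
    using assms(2) by (intro power_increasing) (auto simp: r_def t_def)
  finally have "card (bounded_monoms D (L * t * r)) < card E" by (simp add: cE)
  then have "\<exists>E' c. E' \<subseteq> E \<and> E' \<noteq> {} \<and> (\<forall>b\<in>E'. c b \<noteq> 0) \<and>
      (\<Sum>b\<in>E'. Poly_Mapping.single 0 (c b) * g b) = 0"
    by (rule linear_relation[where g = g, OF cE(1) card_bounded_monoms(1)[OF assms(1)]])
      (use keys in blast)+
  then obtain E' c where E': "E' \<subseteq> E" "E' \<noteq> {}" "\<And>b. b \<in> E' \<Longrightarrow> c b \<noteq> 0"
      "(\<Sum>b\<in>E'. Poly_Mapping.single 0 (c b) * g b) = 0"
    by blast
  show thesis
  proof (rule that)
    fix m :: "'v \<Rightarrow>\<^sub>0 nat" assume m: "Poly_Mapping.keys m \<subseteq> D"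
    have scale: "Poly_Mapping.lookup (Poly_Mapping.single 0 a * p) m = a * Poly_Mapping.lookup p m" for a and p :: "('v, 'k) mpoly"
      using lookup_single_mult[of 0 a p m] by simp
    have "Poly_Mapping.lookup (\<Sum>b\<in>E'. Poly_Mapping.single 0 (c b) * g b) m = 0" by (simp add: E')
    then show "Poly_Mapping.lookup
        (\<Sum>b\<in>E'. Poly_Mapping.single 0 (c b) * (\<Prod>i<length fs. fs ! i ^ (b ! i))) m = 0"
      using m by (simp add: lookup_sum scale g_def h_def r_def lookup_restr)
  qed (use E' cE finite_subset[of E' E] in \<open>auto simp: E_def r_def\<close>)
qed

definition deg_in :: "'v set \<Rightarrow> ('v \<Rightarrow>\<^sub>0 nat) \<Rightarrow> nat" where
  "deg_in V m = (\<Sum>v\<in>V. Poly_Mapping.lookup m v)"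

lemma deg_in_add: "deg_in V (a + b) = deg_in V a + deg_in V b"
  by (simp add: deg_in_def lookup_add sum.distrib)

definition order_ge :: "'v set \<Rightarrow> nat \<Rightarrow> ('v, 'k::comm_ring_1) mpoly \<Rightarrow> bool" where
  "order_ge V d p \<longleftrightarrow> (\<forall>m\<in>Poly_Mapping.keys p. d \<le> deg_in V m)"

lemma order_ge_mult:
  assumes "order_ge V d p" "order_ge V e q"
  shows "order_ge V (d + e) (p * q)"
  unfolding order_ge_def
proof
  fix m assume "m \<in> Poly_Mapping.keys (p * q)"
  then obtain a b where "a \<in> Poly_Mapping.keys p" "b \<in> Poly_Mapping.keys q" "m = a + b"
    using subsetD[OF Poly_Mapping.keys_mult] by fastforce
  then show "d + e \<le> deg_in V m"
    using assms by (simp add: order_ge_def deg_in_add add_mono)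
qed

lemma order_ge_power: "order_ge V 1 p \<Longrightarrow> order_ge V n (p ^ n)"
proof (induction n)
  case (Suc n)
  then show ?case using order_ge_mult[of V 1 p n "p ^ n"] by simp
qed (simp add: order_ge_def)

lemma order_ge_one:
  assumes "finite V" "p \<in> polys V" "Poly_Mapping.lookup p 0 = 0"
  shows "order_ge V 1 p"
  unfolding order_ge_def
proof
  fix m assume m: "m \<in> Poly_Mapping.keys p"
  then have "m \<noteq> 0" using assms(3) by (auto simp: in_keys_iff)
  then obtain v where v: "Poly_Mapping.lookup m v \<noteq> 0"
    by (metis lookup_zero poly_mapping_eqI)
  then have "v \<in> V" using m assms(2) by (auto simp: polys_def in_keys_iff subset_iff)
  then have "Poly_Mapping.lookup m v \<le> deg_in V m"
    unfolding deg_in_def using assms(1) by (intro member_le_sum) auto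
  then show "1 \<le> deg_in V m" using v by simp
qed

section \<open>The length of a regular sequence\<close>

context fin_graph
begin

text \<open>The algebraic relation lives modulo the variables outside \<open>D\<close>. Multiplied by \<open>x\<^sup>D\<close> it becomes a
  relation modulo \<open>I(G)\<close>, as \<open>D\<close> dominates every other vertex. The powers \<open>f\<^bsup>|D|+1\<^esup>\<close> are used so
  that \<open>x\<^sup>D\<close> has too small a degree to lie in the ideal that they generate modulo \<open>I(G)\<close>.\<close>

lemma length_weakly_regular_le:
  fixes fs :: "('v, 'k::field) mpoly list"
  assumes D: "dominating D" "indep D"
    and fs: "\<And>f. f \<in> set fs \<Longrightarrow> f \<in> polys (verts G) \<and> Poly_Mapping.lookup f 0 = 0"
    and reg: "S.weakly_regular (verts G) (edge_ideal G) fs"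
  shows "length fs \<le> card D"
proof (rule ccontr)
  assume "\<not> length fs \<le> card D"
  let ?V = "verts G" and ?I = "edge_ideal G :: ('v, 'k) mpoly set"
  define hs where "hs = map (\<lambda>f. f ^ Suc (card D)) fs"
  have DV: "D \<subseteq> ?V" "finite D"
    using D finite_subset[OF _ finite_verts] by (auto simp: dominating_def)
  define u where "u = (Poly_Mapping.single (expo D) 1 :: ('v, 'k) mpoly)"
  have hs: "set hs \<subseteq> polys ?V" "length hs = length fs"
    using fs by (auto simp: hs_def intro!: S.mult_closed S.power_closed)
  obtain E c where E: "finite E" "E \<noteq> {}" "\<And>b. b \<in> E \<Longrightarrow> length b = length hs"
      "\<And>b. b \<in> E \<Longrightarrow> c b \<noteq> 0"
      "\<And>m. Poly_Mapping.keys m \<subseteq> D \<Longrightarrow> Poly_Mapping.lookup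
        (\<Sum>b\<in>E. Poly_Mapping.single 0 (c b) * (\<Prod>i<length hs. hs ! i ^ (b ! i))) m = 0"
    by (rule algebraic_relation[OF DV(2), of hs]) (use \<open>\<not> length fs \<le> card D\<close> hs(2) in auto)
  define q where "q = (\<Sum>b\<in>E. Poly_Mapping.single 0 (c b) * (\<Prod>i<length hs. hs ! i ^ (b ! i)))"
  have prod: "(\<Prod>i<n. hs ! i ^ (b ! i)) \<in> polys ?V" if "n \<le> length hs" for n b
    using that hs(1)
    by (induction n) (auto simp: S.one_closed intro!: S.mult_closed S.power_closed)
  have qV: "q \<in> polys ?V" unfolding q_def
    by (intro S.sum_closed S.mult_closed single_in_polys prod) auto
  have qu: "q * u \<in> ?I"
  proof -
    have keys: "Poly_Mapping.keys (q * u) = (+) (expo D) ` Poly_Mapping.keys q"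
      using keys_mult_single[of "expo D" q] by (simp add: u_def mult.commute)
    have "\<not> indep (Poly_Mapping.keys (expo D + m))" if m: "m \<in> Poly_Mapping.keys q" for m
    proof
      assume ind: "indep (Poly_Mapping.keys (expo D + m))"
      have "\<not> Poly_Mapping.keys m \<subseteq> D" using E(5) m by (auto simp: q_def in_keys_iff)
      then obtain v where v: "v \<in> Poly_Mapping.keys m" "v \<notin> D" by blast
      then have "v \<in> ?V" using qV m by (auto simp: polys_def)
      then obtain d where "d \<in> D" "d \<in> nbhd v" using D v by (auto simp: dominating_def)
      then show False using ind v DV by (auto simp: indep_def keys_monom_add keys_expo)
    qed
    moreover have "q * u \<in> polys ?V"
      using qV DV by (auto simp: u_def keys_expo intro!: S.mult_closed single_in_polys)
    ultimately show ?thesis by (auto simp: edge_ideal_eq nonface_ideal_def keys)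
  qed
  have reg_hs: "S.weakly_regular ?V ?I hs"
    unfolding hs_def using reg fs
    by (intro S.weakly_regular_powers is_ideal_edge_ideal) auto
  have uV: "u \<in> polys ?V" using DV by (simp add: u_def single_in_polys keys_expo)
  have "u \<in> S.adjoin_list ?V ?I hs"
  proof (rule S.weakly_regular_relation[OF is_ideal_edge_ideal hs(1) uV reg_hs E(1,2,3)])
    show "(\<Sum>b\<in>E. Poly_Mapping.single 0 (c b) * (\<Prod>i<length hs. hs ! i ^ (b ! i))) * u \<in> ?I"
      using qu by (simp only: q_def)
  next
    fix b assume "b \<in> E"
    then show "Poly_Mapping.single 0 (c b) \<in> polys ?V \<and>
        (\<exists>d\<in>polys ?V. d * Poly_Mapping.single 0 (c b) = (1 :: ('v, 'k) mpoly))"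
      using E(4) by (auto simp: single_in_polys mult_single
          intro!: bexI[of _ "Poly_Mapping.single 0 (inverse (c b))"])
  qed
  then obtain y where y: "u - (\<Sum>i<length hs. hs ! i * y i) \<in> ?I"
    unfolding S.adjoin_list_iff by blast
  have "Poly_Mapping.lookup (hs ! i * y i) (expo D) = 0" if "i < length hs" for i
  proof -
    have "order_ge ?V (Suc (card D)) (hs ! i)"
      using that fs finite_verts unfolding hs_def by (auto intro!: order_ge_power[of ?V _ "Suc (card D)", unfolded power_Suc] order_ge_one)
    then have "order_ge ?V (Suc (card D) + 0) (hs ! i * y i)"
      by (rule order_ge_mult) (simp add: order_ge_def)
    moreover have "deg_in ?V (expo D) = card D"
      using DV finite_verts by (simp add: deg_in_def lookup_expo sum.If_cases Int_absorb1)
    ultimately show ?thesis by (force simp: order_ge_def in_keys_iff)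
  qed
  then have "Poly_Mapping.lookup (u - (\<Sum>i<length hs. hs ! i * y i)) (expo D) = 1"
    by (simp add: lookup_minus lookup_sum u_def)
  then have "expo D \<in> Poly_Mapping.keys (u - (\<Sum>i<length hs. hs ! i * y i))"
    by (simp add: in_keys_iff)
  then show False using y D(2) DV by (auto simp: edge_ideal_eq nonface_ideal_def keys_expo)
qed

end

section \<open>Quotients of polynomial rings as modules\<close>

locale poly_quotient =
  fixes V :: "'v set" and J :: "('v, 'k::comm_ring_1) mpoly set"
  assumes J: "S.is_ideal V J"
begin

abbreviation "R \<equiv> mpoly_ring V :: ('v, 'k) mpoly ring"
abbreviation "M \<equiv> quot_module R J"

definition cls :: "('v, 'k) mpoly \<Rightarrow> ('v, 'k) mpoly set" where
  "cls p = J +>\<^bsub>R\<^esub> p"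

lemma ideal_J: "ideal J R"
  using J by (simp add: ideal_iff_is_ideal)

sublocale M: Module.module R M
  by (rule module_quot_module[OF cring_mpoly_ring ideal_J])

lemma cls_eq_image: "cls p = (\<lambda>j. j + p) ` J"
  by (auto simp: cls_def a_r_coset_def r_coset_def)

lemma cls_eq_iff: "cls p = cls q \<longleftrightarrow> p - q \<in> J"
proof
  assume "cls p = cls q"
  then have "p \<in> cls q" using S.ideal_zero[OF J] by (force simp: cls_eq_image)
  then show "p - q \<in> J" by (auto simp: cls_eq_image)
next
  have sub: "cls p \<subseteq> cls q" if "p - q \<in> J" for p q
  proof
    fix x assume "x \<in> cls p"
    then obtain j where "j \<in> J" "x = j + p" by (auto simp: cls_eq_image)
    then have "x = (j + (p - q)) + q" "j + (p - q) \<in> J" using that S.ideal_add[OF J] by auto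
    then show "x \<in> cls q" unfolding cls_eq_image by blast
  qed
  assume "p - q \<in> J"
  then show "cls p = cls q" using sub[of p q] sub[of q p] S.ideal_uminus[OF J, of "p - q"] by auto
qed

lemma cls_eq_0_iff: "cls p = \<zero>\<^bsub>M\<^esub> \<longleftrightarrow> p \<in> J"
proof -
  have "\<zero>\<^bsub>M\<^esub> = cls 0" by (simp add: quot_module_simps FactRing_def cls_eq_image)
  then show ?thesis by (simp add: cls_eq_iff)
qed

lemma carrier_M: "carrier M = cls ` polys V"
  by (auto simp: quot_module_simps FactRing_def A_RCOSETS_def RCOSETS_def cls_def a_r_coset_def)

lemma cls_in_carrier: "p \<in> polys V \<Longrightarrow> cls p \<in> carrier M"
  by (simp add: carrier_M)

lemma cls_hom: "cls \<in> ring_hom R (R Quot J)"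
  using ideal.rcos_ring_hom[OF ideal_J] by (simp add: cls_def[abs_def])

lemma add_cls: "p \<in> polys V \<Longrightarrow> q \<in> polys V \<Longrightarrow> cls p \<oplus>\<^bsub>M\<^esub> cls q = cls (p + q)"
  using ring_hom_add[OF cls_hom] by (simp add: quot_module_simps)

lemma smult_cls: "r \<in> polys V \<Longrightarrow> p \<in> polys V \<Longrightarrow> r \<odot>\<^bsub>M\<^esub> cls p = cls (r * p)"
  using ring_hom_mult[OF cls_hom] by (simp add: quot_module_simps flip: cls_def)

lemma finsum_cls:
  "finite T \<Longrightarrow> (\<And>i. i \<in> T \<Longrightarrow> p i \<in> polys V) \<Longrightarrow> (\<Oplus>\<^bsub>M\<^esub>i\<in>T. cls (p i)) = cls (\<Sum>i\<in>T. p i)"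
proof (induction T rule: finite_induct)
  case empty
  then show ?case using cls_eq_0_iff[of 0] S.ideal_zero[OF J] by simp
next
  case (insert x T)
  then have "(\<Oplus>\<^bsub>M\<^esub>i\<in>insert x T. cls (p i)) = cls (p x) \<oplus>\<^bsub>M\<^esub> (\<Oplus>\<^bsub>M\<^esub>i\<in>T. cls (p i))"
    by (intro M.M.finsum_insert) (auto simp: cls_in_carrier)
  also have "\<dots> = cls (\<Sum>i\<in>insert x T. p i)"
    using insert by (simp add: add_cls S.sum_closed)
  finally show ?case .
qed

lemma cls_in_seq_submodule_iff:
  assumes "set fs \<subseteq> polys V" "i \<le> length fs" "x \<in> polys V"
  shows "cls x \<in> seq_submodule R M fs i \<longleftrightarrow> x \<in> S.adjoin_list V J (take i fs)"
proof -
  have fs: "fs ! j \<in> polys V" if "j < i" for j using assms that by (auto simp: subset_iff)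
  have sum: "(\<Oplus>\<^bsub>M\<^esub>j\<in>{..<i}. fs ! j \<odot>\<^bsub>M\<^esub> cls (y j)) = cls (\<Sum>j<i. fs ! j * y j)"
    if "y \<in> {..<i} \<rightarrow> polys V" for y
  proof -
    have "(\<Oplus>\<^bsub>M\<^esub>j\<in>{..<i}. fs ! j \<odot>\<^bsub>M\<^esub> cls (y j)) = (\<Oplus>\<^bsub>M\<^esub>j\<in>{..<i}. cls (fs ! j * y j))"
      using that fs by (intro M.M.finsum_cong') (simp_all add: Pi_iff smult_cls cls_in_carrier S.mult_closed)
    also have "\<dots> = cls (\<Sum>j<i. fs ! j * y j)"
      using that fs by (intro finsum_cls) (auto intro!: S.mult_closed)
    finally show ?thesis .
  qed
  have "cls x \<in> seq_submodule R M fs i \<longleftrightarrow>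
      (\<exists>y \<in> {..<i} \<rightarrow> polys V. cls x = cls (\<Sum>j<i. fs ! j * y j))" (is "?L \<longleftrightarrow> ?R")
  proof
    assume ?L
    then obtain y where y: "y \<in> {..<i} \<rightarrow> carrier M" "cls x = (\<Oplus>\<^bsub>M\<^esub>j\<in>{..<i}. fs ! j \<odot>\<^bsub>M\<^esub> y j)"
      by (auto simp: seq_submodule_def)
    then have "\<forall>j\<in>{..<i}. \<exists>z\<in>polys V. y j = cls z"
      unfolding carrier_M by (blast dest: funcset_mem)
    then obtain z where z: "\<And>j. j < i \<Longrightarrow> z j \<in> polys V \<and> y j = cls (z j)" by (metis lessThan_iff)
    have "cls x = (\<Oplus>\<^bsub>M\<^esub>j\<in>{..<i}. fs ! j \<odot>\<^bsub>M\<^esub> cls (z j))"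
      unfolding y(2) using z fs by (intro M.M.finsum_cong') (auto intro!: M.smult_closed cls_in_carrier)
    then show ?R using z sum[of z] by (intro bexI[of _ z]) auto
  next
    assume ?R
    then obtain y where y: "y \<in> {..<i} \<rightarrow> polys V" "cls x = cls (\<Sum>j<i. fs ! j * y j)" by blast
    then have "cls x = (\<Oplus>\<^bsub>M\<^esub>j\<in>{..<i}. fs ! j \<odot>\<^bsub>M\<^esub> cls (y j))" using sum by simp
    moreover have "(\<lambda>j. cls (y j)) \<in> {..<i} \<rightarrow> carrier M" using y(1) by (auto intro: cls_in_carrier)
    ultimately show ?L unfolding seq_submodule_def by (auto intro!: exI[of _ "\<lambda>j. cls (y j)"])
  qed
  then show ?thesis
    using assms(2) by (simp add: S.adjoin_list_iff cls_eq_iff min_absorb2)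
qed

lemma regular_sequence_iff:
  assumes "set fs \<subseteq> polys V"
  shows "regular_sequence R M fs \<longleftrightarrow>
    S.weakly_regular V J fs \<and> S.adjoin_list V J fs \<noteq> polys V"
proof -
  have 1: "(\<forall>x\<in>carrier M. fs ! i \<odot>\<^bsub>M\<^esub> x \<in> seq_submodule R M fs i \<longrightarrow> x \<in> seq_submodule R M fs i) \<longleftrightarrow>
      S.nzd V (fs ! i) (S.adjoin_list V J (take i fs))" if i: "i < length fs" for i
  proof -
    have f: "fs ! i \<in> polys V" using assms i by auto
    show ?thesis unfolding carrier_M S.nzd_def
      using assms i f by (auto simp: smult_cls cls_in_seq_submodule_iff S.mult_closed)
  qed
  have sub: "seq_submodule R M fs (length fs) \<subseteq> carrier M"
    using assms unfolding seq_submodule_def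
    by (auto intro!: M.M.finsum_closed M.smult_closed simp: subset_iff)
  have "seq_submodule R M fs (length fs) = carrier M \<longleftrightarrow>
      (\<forall>x\<in>polys V. cls x \<in> seq_submodule R M fs (length fs))"
    using sub unfolding carrier_M by blast
  also have "\<dots> \<longleftrightarrow> S.adjoin_list V J fs = polys V"
    using assms S.is_ideal_adjoin_list[OF J, of fs] S.ideal_sub
    by (auto simp: cls_in_seq_submodule_iff)
  finally show ?thesis
    using 1 assms by (auto simp: regular_sequence_def S.weakly_regular_iff)
qed

lemma stanley_space_cls:
  assumes "A \<subseteq> V" "w \<in> polys V"
  shows "stanley_space M (cls w) A = {cls (q * w) |q. q \<in> polys A}"
proof -
  have "p \<odot>\<^bsub>M\<^esub> cls w = cls (p * w)" if "p \<in> polys A" for p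
    using polys_mono[OF assms(1) that] assms(2) by (simp add: smult_cls)
  then show ?thesis by (auto simp: stanley_space_def)
qed

lemma module_stanley_space:
  assumes A: "A \<subseteq> V" and w: "w \<in> polys V"
  shows "Module.module (mpoly_ring A :: ('v, 'k) mpoly ring) (M\<lparr>carrier := stanley_space M (cls w) A\<rparr>)"
    (is "Module.module ?R ?N")
proof -
  have AV: "p \<in> polys V" if "p \<in> polys A" for p :: "('v, 'k) mpoly" using polys_mono[OF A that] .
  note space = stanley_space_cls[OF A w]
  have sub: "stanley_space M (cls w) A \<subseteq> carrier M"
    unfolding space using AV w by (auto intro!: cls_in_carrier S.mult_closed)
  have add: "cls (p * w) \<oplus>\<^bsub>M\<^esub> cls (q * w) = cls ((p + q) * w)" if "p \<in> polys A" "q \<in> polys A" for p q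
    using AV[OF that(1)] AV[OF that(2)] w by (simp add: add_cls S.mult_closed distrib_right)
  have zero: "\<zero>\<^bsub>M\<^esub> = cls (0 * w)" using cls_eq_0_iff[of 0] S.ideal_zero[OF J] by simp
  show ?thesis
  proof (rule moduleI)
    show "cring (mpoly_ring A :: ('v, 'k) mpoly ring)" by (rule cring_mpoly_ring)
    show "abelian_group ?N"
    proof (rule abelian_groupI)
      fix x y assume "x \<in> carrier ?N" "y \<in> carrier ?N"
      then show "x \<oplus>\<^bsub>?N\<^esub> y \<in> carrier ?N"
        using add by (auto simp: space intro: S.add_closed)
    next
      show "\<zero>\<^bsub>?N\<^esub> \<in> carrier ?N" using zero S.zero_closed by (auto simp: space intro!: exI[of _ 0])
    next
      fix x assume "x \<in> carrier ?N"
      then obtain q where q: "q \<in> polys A" "x = cls (q * w)" by (auto simp: space)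
      then have "cls (- q * w) \<oplus>\<^bsub>M\<^esub> x = \<zero>\<^bsub>M\<^esub>"
        using add[OF S.uminus_closed q(1), OF q(1)] zero by simp
      then show "\<exists>y\<in>carrier ?N. y \<oplus>\<^bsub>?N\<^esub> x = \<zero>\<^bsub>?N\<^esub>"
        using q S.uminus_closed
        by (intro bexI[of _ "cls (- q * w)"]) (auto simp: space simp del: mult_minus_left)
    next
      fix x y z assume "x \<in> carrier ?N" "y \<in> carrier ?N" "z \<in> carrier ?N"
      then show "x \<oplus>\<^bsub>?N\<^esub> y \<oplus>\<^bsub>?N\<^esub> z = x \<oplus>\<^bsub>?N\<^esub> (y \<oplus>\<^bsub>?N\<^esub> z)"
        using M.M.a_assoc[of x y z] sub by (simp add: subset_iff)
    next
      fix x y assume "x \<in> carrier ?N" "y \<in> carrier ?N"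
      then show "x \<oplus>\<^bsub>?N\<^esub> y = y \<oplus>\<^bsub>?N\<^esub> x"
        using M.M.a_comm[of x y] sub by (simp add: subset_iff)
    qed (use sub in \<open>simp add: subset_iff\<close>)
  next
    fix a x assume "a \<in> carrier ?R" "x \<in> carrier ?N"
    then obtain q where q: "a \<in> polys A" "q \<in> polys A" "x = cls (q * w)" by (auto simp: space)
    then have "a \<odot>\<^bsub>M\<^esub> x = cls ((a * q) * w)"
      using AV w by (simp add: smult_cls S.mult_closed mult.assoc)
    then show "a \<odot>\<^bsub>?N\<^esub> x \<in> carrier ?N"
      using q by (auto simp: space intro: S.mult_closed)
  next
    fix a b x assume "a \<in> carrier ?R" "b \<in> carrier ?R" "x \<in> carrier ?N"
    then show "(a \<oplus>\<^bsub>?R\<^esub> b) \<odot>\<^bsub>?N\<^esub> x = a \<odot>\<^bsub>?N\<^esub> x \<oplus>\<^bsub>?N\<^esub> b \<odot>\<^bsub>?N\<^esub> x"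
      using M.smult_l_distr[of a b x] AV sub by auto
  next
    fix a x y assume "a \<in> carrier ?R" "x \<in> carrier ?N" "y \<in> carrier ?N"
    then show "a \<odot>\<^bsub>?N\<^esub> (x \<oplus>\<^bsub>?N\<^esub> y) = a \<odot>\<^bsub>?N\<^esub> x \<oplus>\<^bsub>?N\<^esub> a \<odot>\<^bsub>?N\<^esub> y"
      using M.smult_r_distr[of a x y] AV sub by auto
  next
    fix a b x assume "a \<in> carrier ?R" "b \<in> carrier ?R" "x \<in> carrier ?N"
    then show "(a \<otimes>\<^bsub>?R\<^esub> b) \<odot>\<^bsub>?N\<^esub> x = a \<odot>\<^bsub>?N\<^esub> (b \<odot>\<^bsub>?N\<^esub> x)"
      using M.smult_assoc1[of a b x] AV sub by auto
  next
    fix x assume "x \<in> carrier ?N"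
    then show "\<one>\<^bsub>?R\<^esub> \<odot>\<^bsub>?N\<^esub> x = x" using M.smult_one[of x] sub by auto
  qed
qed

text \<open>A torsion-free cyclic module is free on its generator. A function \<open>c\<close> as in the definition of a free
  module is then determined by its value at the generator.\<close>

lemma free_stanley_space:
  assumes A: "A \<subseteq> V" and w: "w \<in> polys V"
    and inj: "\<And>q. q \<in> polys A \<Longrightarrow> q * w \<in> J \<Longrightarrow> q = 0"
  shows "free_module (mpoly_ring A :: ('v, 'k) mpoly ring) (M\<lparr>carrier := stanley_space M (cls w) A\<rparr>)"
    (is "free_module ?R ?N")
proof -
  interpret N: Module.module ?R ?N by (rule module_stanley_space[OF A w])
  have AV: "p \<in> polys V" if "p \<in> polys A" for p :: "('v, 'k) mpoly" using polys_mono[OF A that] .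
  note space = stanley_space_cls[OF A w]
  have "1 * w = w" by simp
  then have wN: "cls w \<in> carrier ?N" using S.one_closed by (force simp: space)
  define good where "good x c \<longleftrightarrow> c \<in> {cls w} \<rightarrow> carrier ?R \<and> (\<forall>b. b \<notin> {cls w} \<longrightarrow> c b = \<zero>\<^bsub>?R\<^esub>) \<and>
      finite {b. c b \<noteq> \<zero>\<^bsub>?R\<^esub>} \<and> x = (\<Oplus>\<^bsub>?N\<^esub>b\<in>{b. c b \<noteq> \<zero>\<^bsub>?R\<^esub>}. c b \<odot>\<^bsub>?N\<^esub> b)" for x c
  have good_iff: "good x c \<longleftrightarrow> c (cls w) \<in> polys A \<and> (\<forall>b. b \<noteq> cls w \<longrightarrow> c b = 0) \<and> x = cls (c (cls w) * w)"
    for x c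
  proof (cases "c (cls w) \<in> polys A \<and> (\<forall>b. b \<noteq> cls w \<longrightarrow> c b = 0)")
    case True
    have "{b. c b \<noteq> 0} = (if c (cls w) = 0 then {} else {cls w})"
      using True by (auto split: if_splits) metis
    moreover have "c (cls w) \<odot>\<^bsub>M\<^esub> cls w = cls (c (cls w) * w)"
      using True AV w by (simp add: smult_cls)
    moreover have "cls (c (cls w) * w) \<in> carrier ?N" using True by (auto simp: space)
    moreover have "cls 0 = \<zero>\<^bsub>?N\<^esub>" using cls_eq_0_iff[of 0] S.ideal_zero[OF J] by simp
    ultimately have "(\<Oplus>\<^bsub>?N\<^esub>b\<in>{b. c b \<noteq> 0}. c b \<odot>\<^bsub>?N\<^esub> b) = cls (c (cls w) * w)"
      using N.M.finsum_insert[of "{}" "cls w" "\<lambda>b. c b \<odot>\<^bsub>?N\<^esub> b"] N.M.finsum_empty N.M.r_zero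
      by auto
    then show ?thesis using True \<open>{b. c b \<noteq> 0} = _\<close> by (auto simp: good_def)
  next
    case False
    then show ?thesis by (auto simp: good_def)
  qed
  have "\<exists>!c. good x c" if "x \<in> carrier ?N" for x
  proof -
    obtain q where q: "q \<in> polys A" "x = cls (q * w)" using \<open>x \<in> carrier ?N\<close> by (auto simp: space)
    show ?thesis
    proof (rule ex1I)
      show "good x (\<lambda>b. if b = cls w then q else 0)" using q by (simp add: good_iff)
    next
      fix c assume "good x c"
      then have c: "c (cls w) \<in> polys A" "\<And>b. b \<noteq> cls w \<Longrightarrow> c b = 0" "x = cls (c (cls w) * w)"
        by (auto simp: good_iff)
      then have "cls (c (cls w) * w) = cls (q * w)" using q by metis
      then have "(c (cls w) - q) * w \<in> J" by (simp add: cls_eq_iff left_diff_distrib)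
      then have "c (cls w) - q = 0" using c q by (intro inj S.diff_closed)
      then show "c = (\<lambda>b. if b = cls w then q else 0)" using c by auto
    qed
  qed
  then show ?thesis unfolding free_module_def good_def using wN
    by (intro exI[of _ "{cls w}"]) auto
qed

text \<open>Free modules have no torsion. Only multiplication by monomials is considered, because for these the
  cancellation law in the polynomial ring is immediate.\<close>

lemma monomial_smult_eq_0:
  assumes A: "A \<subseteq> V" and w: "w \<in> polys V"
    and free: "free_module (mpoly_ring A :: ('v, 'k) mpoly ring) (M\<lparr>carrier := stanley_space M (cls w) A\<rparr>)"
      (is "free_module ?R ?N")
    and m: "Poly_Mapping.keys m \<subseteq> A" and 0: "Poly_Mapping.single m 1 * w \<in> J"
  shows "w \<in> J"
proof -
  interpret N: Module.module ?R ?N by (rule module_stanley_space[OF A w])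
  have AV: "p \<in> polys V" if "p \<in> polys A" for p :: "('v, 'k) mpoly" using polys_mono[OF A that] .
  note space = stanley_space_cls[OF A w]
  let ?r = "Poly_Mapping.single m 1 :: ('v, 'k) mpoly"
  have r: "?r \<in> polys A" using m by (rule single_in_polys)
  have r_inj: "?r * p = 0 \<longleftrightarrow> p = 0" for p
    using keys_mult_single[of m p] by (metis image_is_empty keys_eq_empty mult_zero_right)
  have "1 * w = w" by simp
  then have wN: "cls w \<in> carrier ?N" using S.one_closed by (force simp: space)
  define good where "good B x c \<longleftrightarrow> c \<in> B \<rightarrow> carrier ?R \<and> (\<forall>b. b \<notin> B \<longrightarrow> c b = \<zero>\<^bsub>?R\<^esub>) \<and>
      finite {b. c b \<noteq> \<zero>\<^bsub>?R\<^esub>} \<and> x = (\<Oplus>\<^bsub>?N\<^esub>b\<in>{b. c b \<noteq> \<zero>\<^bsub>?R\<^esub>}. c b \<odot>\<^bsub>?N\<^esub> b)" for B x c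
  have "\<exists>B\<subseteq>carrier ?N. \<forall>x\<in>carrier ?N. \<exists>!c. good B x c"
    using free unfolding free_module_def good_def .
  then obtain B where B: "B \<subseteq> carrier ?N \<and> (\<forall>x\<in>carrier ?N. \<exists>!c. good B x c)" ..
  note B1 = conjunct1[OF B] and B2 = bspec[OF conjunct2[OF B]]
  obtain c where c: "good B (cls w) c" using ex1_implies_ex[OF B2[OF wN]] ..
  define T where "T = {b. c b \<noteq> 0}"
  define s where "s = (\<Oplus>\<^bsub>?N\<^esub>b\<in>T. c b \<odot>\<^bsub>?N\<^esub> b)"
  have T: "finite T" "T \<subseteq> B" "\<And>b. b \<in> T \<Longrightarrow> c b \<in> polys A"
    using c by (auto simp: good_def T_def)
  have closed: "c b \<odot>\<^bsub>?N\<^esub> b \<in> carrier ?N" if "b \<in> T" for b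
    using T B1 that by (intro N.smult_closed) auto
  have s: "cls w = s"
    using c unfolding good_def s_def T_def by simp
  have "\<zero>\<^bsub>?N\<^esub> = ?r \<odot>\<^bsub>?N\<^esub> cls w"
    using smult_cls[OF AV[OF r] w] iffD2[OF cls_eq_0_iff 0] by simp
  also have "\<dots> = ?r \<odot>\<^bsub>?N\<^esub> s" using s by (rule arg_cong)
  also have "\<dots> = (\<Oplus>\<^bsub>?N\<^esub>b\<in>T. ?r \<odot>\<^bsub>?N\<^esub> (c b \<odot>\<^bsub>?N\<^esub> b))"
    unfolding s_def using T r closed by (intro N.finsum_smult_ldistr) auto
  also have "\<dots> = (\<Oplus>\<^bsub>?N\<^esub>b\<in>T. (?r * c b) \<odot>\<^bsub>?N\<^esub> b)"
  proof (intro N.M.finsum_cong')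
    have "(?r * c b) \<odot>\<^bsub>?N\<^esub> b \<in> carrier ?N" if "b \<in> T" for b
      using T B1 r that by (intro N.smult_closed) (auto intro!: S.mult_closed)
    then show "(\<lambda>b. (?r * c b) \<odot>\<^bsub>?N\<^esub> b) \<in> T \<rightarrow> carrier ?N" by blast
  qed (use T B1 r N.smult_assoc1[of ?r] in auto)
  finally have "good B \<zero>\<^bsub>?N\<^esub> (\<lambda>b. ?r * c b)"
    using c r by (auto simp: good_def r_inj T_def intro!: S.mult_closed)
  moreover have "good B \<zero>\<^bsub>?N\<^esub> (\<lambda>b. 0)"
    using N.M.finsum_empty S.zero_closed by (auto simp: good_def)
  ultimately have "(\<lambda>b. ?r * c b) = (\<lambda>b. 0)"
    using B2[OF N.M.zero_closed] by (elim ex1E) metis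
  then have "T = {}" using r_inj by (auto simp: T_def fun_eq_iff)
  then have "s = \<zero>\<^bsub>M\<^esub>" using N.M.finsum_empty by (simp add: s_def)
  with s have "cls w = \<zero>\<^bsub>M\<^esub>" by simp
  then show ?thesis by (simp add: cls_eq_0_iff)
qed

end

section \<open>Depth of an edge ring\<close>

context fin_graph
begin

abbreviation "S \<equiv> mpoly_ring (verts G) :: ('v, 'k::field) mpoly ring"

sublocale Q: poly_quotient "verts G" "edge_ideal G :: ('v, 'k::field) mpoly set"
  by unfold_locales (rule is_ideal_edge_ideal)

lemma irrelevant_ideal_is_ideal: "S.is_ideal V (irrelevant_ideal V :: ('x, 'k::field) mpoly set)"
proof -
  interpret cring "mpoly_ring V :: ('x, 'k) mpoly ring" by (rule cring_mpoly_ring)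
  have "Var ` V \<subseteq> carrier (mpoly_ring V :: ('x, 'k) mpoly ring)" by auto
  then show ?thesis
    unfolding irrelevant_ideal_def by (simp add: genideal_ideal flip: ideal_iff_is_ideal)
qed

lemma irrelevant_ideal_sub:
  assumes "p \<in> (irrelevant_ideal V :: ('x, 'k::field) mpoly set)"
  shows "p \<in> polys V \<and> Poly_Mapping.lookup p 0 = 0"
proof -
  have "(irrelevant_ideal V :: ('x, 'k) mpoly set) \<subseteq> nonface_ideal V (\<lambda>T. T = {})"
  proof -
    have "ideal (nonface_ideal V (\<lambda>T. T = {}) :: ('x, 'k) mpoly set) (mpoly_ring V)"
      unfolding ideal_iff_is_ideal by (rule is_ideal_nonface_ideal) blast
    moreover have "Var ` V \<subseteq> (nonface_ideal V (\<lambda>T. T = {}) :: ('x, 'k) mpoly set)"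
      by (auto simp: nonface_ideal_def simp del: keys_eq_empty)
        (simp add: Var_def del: keys_eq_empty)
    ultimately show ?thesis unfolding irrelevant_ideal_def genideal_def by blast
  qed
  then show ?thesis using assms by (fastforce simp: nonface_ideal_def in_keys_iff)
qed

lemma depth_ge:
  assumes "packing A"
  shows "enat (card A) \<le> depth S (irrelevant_ideal (verts G)) (quot_module S (edge_ideal G :: ('v, 'k::field) mpoly set))"
proof -
  have "finite A" using assms finite_subset[OF _ finite_verts] by (auto simp: packing_def)
  then obtain as where as: "set as = A" "distinct as" using finite_distinct_list by blast
  let ?fs = "map star_form as :: ('v, 'k) mpoly list"
  let ?V = "verts G"
  have irr: "set ?fs \<subseteq> irrelevant_ideal ?V"
  proof -
    have "Var v \<in> (irrelevant_ideal ?V :: ('v, 'k) mpoly set)" if "v \<in> ?V" for v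
      using that unfolding irrelevant_ideal_def genideal_def by auto
    moreover have "insert a (nbhd a) \<subseteq> ?V" if "a \<in> A" for a
      using that assms nbhd_verts by (auto simp: packing_def)
    ultimately show ?thesis
      using as unfolding star_form_def
      by (auto intro!: S.ideal_sum[OF irrelevant_ideal_is_ideal] simp del: sum.insert)
  qed
  then have fsV: "set ?fs \<subseteq> polys ?V" using irrelevant_ideal_sub by blast
  have "S.adjoin_list ?V (edge_ideal G) ?fs \<noteq> polys ?V"
  proof
    assume "S.adjoin_list ?V (edge_ideal G) ?fs = polys ?V"
    then have "1 \<in> S.adjoin_list ?V (edge_ideal G) ?fs" using S.one_closed by blast
    then obtain y where y: "y \<in> {..<length ?fs} \<rightarrow> polys ?V"
        "1 - (\<Sum>i<length ?fs. ?fs ! i * y i) \<in> edge_ideal G" (is "?p \<in> _")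
      unfolding S.adjoin_list_iff by blast
    have sum: "(\<Sum>i<length ?fs. ?fs ! i * y i) \<in> irrelevant_ideal ?V"
    proof (intro S.ideal_sum[OF irrelevant_ideal_is_ideal] S.ideal_mult_right[OF irrelevant_ideal_is_ideal])
      fix i assume i: "i \<in> {..<length ?fs}"
      then show "?fs ! i \<in> irrelevant_ideal ?V" using irr nth_mem[of i ?fs] by blast
      show "y i \<in> polys ?V" using y(1) i by (rule funcset_mem)
    qed
    have "Poly_Mapping.lookup ?p 0 = 1"
      using irrelevant_ideal_sub[OF sum] by (simp only: lookup_minus lookup_one_zero diff_zero)
    then have "0 \<in> Poly_Mapping.keys ?p" by (simp add: in_keys_iff)
    then show False using y(2) by (auto simp: edge_ideal_eq nonface_ideal_def indep_empty)
  qed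
  then have "regular_sequence S (quot_module S (edge_ideal G)) ?fs"
    using Q.regular_sequence_iff[OF fsV] weakly_regular_star_forms[of as] assms as by blast
  then have "enat (length ?fs) \<le> depth S (irrelevant_ideal ?V) (quot_module S (edge_ideal G :: ('v, 'k) mpoly set))"
    unfolding depth_def using irr by (intro SUP_upper) auto
  then show ?thesis using as distinct_card[of as] by simp
qed

lemma depth_le:
  assumes "dominating D" "indep D"
  shows "depth S (irrelevant_ideal (verts G)) (quot_module S (edge_ideal G :: ('v, 'k::field) mpoly set)) \<le> enat (card D)"
  unfolding depth_def
proof (rule SUP_least)
  fix fs :: "('v, 'k) mpoly list"
  assume "fs \<in> {fs. set fs \<subseteq> irrelevant_ideal (verts G) \<and> regular_sequence S (quot_module S (edge_ideal G)) fs}"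
  then have fs: "set fs \<subseteq> irrelevant_ideal (verts G)" "regular_sequence S (quot_module S (edge_ideal G)) fs"
    by auto
  have *: "f \<in> polys (verts G) \<and> Poly_Mapping.lookup f 0 = 0" if "f \<in> set fs" for f
    using fs(1) that irrelevant_ideal_sub by blast
  then have "S.weakly_regular (verts G) (edge_ideal G) fs"
    using fs(2) Q.regular_sequence_iff[of fs] by blast
  then show "enat (length fs) \<le> enat (card D)"
    using length_weakly_regular_le[OF assms *] by simp
qed

section \<open>Stanley depth of an edge ring\<close>

text \<open>A partition of the independence complex into intervals \<open>[F, A]\<close> partitions the monomials outside
  \<open>I(G)\<close> into the monomials of the spaces \<open>x\<^sup>F K[A]\<close>: a monomial belongs to this space iff its support
  lies in the interval.\<close>

lemma stanley_decomposition_of_intervals: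
  fixes FA :: "('v set \<times> 'v set) list"
  assumes FA: "\<And>F A. (F, A) \<in> set FA \<Longrightarrow> F \<subseteq> A \<and> A \<subseteq> verts G \<and> indep A"
    and part: "\<And>T. T \<subseteq> verts G \<Longrightarrow> indep T \<Longrightarrow>
      \<exists>!i. i < length FA \<and> fst (FA ! i) \<subseteq> T \<and> T \<subseteq> snd (FA ! i)"
  shows "stanley_decomposition (verts G) (quot_grading (verts G) (edge_ideal G))
    (quot_module S (edge_ideal G :: ('v, 'k::field) mpoly set))
    (map (\<lambda>(F, A). (Q.cls (Poly_Mapping.single (expo F) 1), A)) FA)"
proof -
  let ?V = "verts G" and ?I = "edge_ideal G :: ('v, 'k) mpoly set"
  let ?M = "quot_module S ?I" and ?mon = "\<lambda>F. Poly_Mapping.single (expo F) 1 :: ('v, 'k) mpoly"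
  let ?D = "map (\<lambda>(F, A). (Q.cls (?mon F), A)) FA"
  define inb where "inb i m \<longleftrightarrow> fst (FA ! i) \<subseteq> Poly_Mapping.keys m \<and> Poly_Mapping.keys m \<subseteq> snd (FA ! i)"
    for i and m :: "'v \<Rightarrow>\<^sub>0 nat"
  have FAi: "fst (FA ! i) \<subseteq> snd (FA ! i)" "snd (FA ! i) \<subseteq> ?V" "indep (snd (FA ! i))"
    if "i < length FA" for i
    using FA[of "fst (FA ! i)" "snd (FA ! i)"] that by auto
  have fin: "finite F" if "F \<subseteq> ?V" for F using that finite_verts by (rule finite_subset)
  have monV: "?mon F \<in> polys ?V" if "F \<subseteq> ?V" for F
    using that fin by (simp add: single_in_polys keys_expo)
  have space: "stanley_space ?M (fst (?D ! i)) (snd (?D ! i)) =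
      {Q.cls p |p. p \<in> polys ?V \<and> (\<forall>m\<in>Poly_Mapping.keys p. inb i m)}" if i: "i < length FA" for i
  proof -
    let ?F = "fst (FA ! i)" and ?A = "snd (FA ! i)"
    have FV: "?F \<subseteq> ?V" "finite ?F" using FAi[OF i] fin by auto
    have "fst (?D ! i) = Q.cls (?mon ?F)" "snd (?D ! i) = ?A" using i by (simp_all add: case_prod_beta)
    then have "stanley_space ?M (fst (?D ! i)) (snd (?D ! i)) = {Q.cls (q * ?mon ?F) |q. q \<in> polys ?A}"
      using Q.stanley_space_cls[OF FAi(2)[OF i] monV[OF FV(1)]] by simp
    also have "\<dots> = {Q.cls p |p. p \<in> polys ?V \<and> (\<forall>m\<in>Poly_Mapping.keys p. inb i m)}"
    proof (intro equalityI subsetI)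
      fix x assume "x \<in> {Q.cls (q * ?mon ?F) |q. q \<in> polys ?A}"
      then obtain q where q: "q \<in> polys ?A" "x = Q.cls (q * ?mon ?F)" by blast
      have "q * ?mon ?F \<in> polys ?V"
        using polys_mono[OF FAi(2)[OF i] q(1)] monV[OF FV(1)] by (rule S.mult_closed)
      moreover have "inb i m" if m: "m \<in> Poly_Mapping.keys (q * ?mon ?F)" for m
      proof -
        obtain k where k: "k \<in> Poly_Mapping.keys q" "m = expo ?F + k"
          using m keys_mult_single[of "expo ?F" q] by (auto simp: mult.commute)
        then have "Poly_Mapping.keys k \<subseteq> ?A" using q(1) by (simp add: polys_def)
        then show ?thesis using k FAi(1)[OF i] FV by (simp add: inb_def keys_monom_add keys_expo)
      qed
      ultimately show "x \<in> {Q.cls p |p. p \<in> polys ?V \<and> (\<forall>m\<in>Poly_Mapping.keys p. inb i m)}"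
        using q by blast
    next
      fix x :: "('v, 'k) mpoly set" assume "x \<in> {Q.cls p |p. p \<in> polys ?V \<and> (\<forall>m\<in>Poly_Mapping.keys p. inb i m)}"
      then obtain p where p: "\<And>m. m \<in> Poly_Mapping.keys p \<Longrightarrow> inb i m" "x = Q.cls p" by blast
      obtain q where "q \<in> polys ?A" "p = ?mon ?F * q"
        by (rule monom_factor[of p ?F ?A]) (use p FV in \<open>auto simp: inb_def\<close>)
      then show "x \<in> {Q.cls (q * ?mon ?F) |q. q \<in> polys ?A}" using p by (auto simp: mult.commute)
    qed
    finally show ?thesis .
  qed
  have unique: "i = j" if "i < length FA" "j < length FA" "inb i m" "inb j m" for i j m
  proof -
    have "Poly_Mapping.keys m \<subseteq> ?V" "indep (Poly_Mapping.keys m)"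
      using that FAi indep_mono unfolding inb_def by blast+
    then show ?thesis using part that unfolding inb_def by blast
  qed
  have 1: "w \<in> carrier ?M \<and> (\<exists>a. w \<in> quot_grading ?V ?I a) \<and> A \<subseteq> ?V \<and>
      free_module (mpoly_ring A :: ('v, 'k) mpoly ring) (?M\<lparr>carrier := stanley_space ?M w A\<rparr>)"
    if wA: "(w, A) \<in> set ?D" for w A
  proof -
    obtain F where F: "(F, A) \<in> set FA" "w = Q.cls (?mon F)" using wA by auto
    note FA = FA[OF F(1)]
    have FV: "F \<subseteq> ?V" "finite F" using FA fin by auto
    have "?mon F \<in> mpoly_grading ?V (\<lambda>v. int (Poly_Mapping.lookup (expo F) v))"
      using monV[OF FV(1)] by (simp add: mpoly_grading_def)
    then have "w \<in> quot_grading ?V ?I (\<lambda>v. int (Poly_Mapping.lookup (expo F) v))"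
      using F by (auto simp: quot_grading_def Q.cls_def)
    moreover have "q = 0" if q: "q \<in> polys A" "q * ?mon F \<in> ?I" for q
    proof (rule ccontr)
      assume "q \<noteq> 0"
      then obtain m where m: "m \<in> Poly_Mapping.keys q" by (metis keys_eq_empty ex_in_conv)
      then have "expo F + m \<in> Poly_Mapping.keys (q * ?mon F)"
        using keys_mult_single[of "expo F" q] by (simp add: mult.commute)
      then have "\<not> indep (F \<union> Poly_Mapping.keys m)"
        using q(2) FV by (force simp: edge_ideal_eq nonface_ideal_def keys_monom_add keys_expo)
      moreover have "F \<union> Poly_Mapping.keys m \<subseteq> A" using FA q(1) m by (auto simp: polys_def)
      ultimately show False using FA indep_mono by blast
    qed
    then have "free_module (mpoly_ring A :: ('v, 'k) mpoly ring) (?M\<lparr>carrier := stanley_space ?M w A\<rparr>)"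
      unfolding F(2) using FA monV[OF FV(1)] by (intro Q.free_stanley_space) auto
    ultimately show ?thesis
      using F FA monV[OF FV(1)] Q.cls_in_carrier by blast
  qed
  have 2: "\<exists>!u. u \<in> (\<Pi>\<^sub>E i\<in>{..<length ?D}. stanley_space ?M (fst (?D ! i)) (snd (?D ! i))) \<and>
      x = (\<Oplus>\<^bsub>?M\<^esub>i\<in>{..<length ?D}. u i)" if "x \<in> carrier ?M" for x
  proof (rule ex_ex1I)
    obtain p where p: "p \<in> polys ?V" "x = Q.cls p" using \<open>x \<in> carrier ?M\<close> by (auto simp: Q.carrier_M)
    let ?p = "\<lambda>i. restr (inb i) p"
    have pV: "?p i \<in> polys ?V" for i using p(1) by (auto simp: polys_def keys_restr)
    let ?u = "\<lambda>i\<in>{..<length FA}. Q.cls (?p i)"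
    have "?u \<in> (\<Pi>\<^sub>E i\<in>{..<length ?D}. stanley_space ?M (fst (?D ! i)) (snd (?D ! i)))"
      using pV by (auto simp: space simp del: nth_map) (auto simp: keys_restr)
    moreover have "x = (\<Oplus>\<^bsub>?M\<^esub>i\<in>{..<length ?D}. ?u i)"
    proof -
      have "(\<Oplus>\<^bsub>?M\<^esub>i\<in>{..<length ?D}. ?u i) = (\<Oplus>\<^bsub>?M\<^esub>i\<in>{..<length FA}. Q.cls (?p i))"
        using pV Q.cls_in_carrier by (intro Q.M.M.finsum_cong') auto
      also have "\<dots> = Q.cls (\<Sum>i<length FA. ?p i)" using pV by (intro Q.finsum_cls) auto
      finally have sum: "(\<Oplus>\<^bsub>?M\<^esub>i\<in>{..<length ?D}. ?u i) = Q.cls (\<Sum>i<length FA. ?p i)" .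
      have "Poly_Mapping.lookup (p - (\<Sum>i<length FA. ?p i)) m = 0"
        if ind: "indep (Poly_Mapping.keys m)" for m
      proof (cases "Poly_Mapping.keys m \<subseteq> ?V")
        case True
        then obtain i where i: "i < length FA" "inb i m" 
          using part[OF True ind] unfolding inb_def by blast
        have "(\<Sum>j<length FA. Poly_Mapping.lookup (?p j) m) =
            (\<Sum>j<length FA. if j = i then Poly_Mapping.lookup p m else 0)"
          using i unique by (intro sum.cong) (auto simp: lookup_restr when_def)
        then show ?thesis using i by (simp add: lookup_minus lookup_sum)
      next
        case False
        then have "m \<notin> Poly_Mapping.keys p" using p(1) by (auto simp: polys_def)
        then show ?thesis by (simp add: lookup_minus lookup_sum lookup_restr in_keys_iff)
      qed
      moreover have "p - (\<Sum>i<length FA. ?p i) \<in> polys ?V"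
        using p(1) pV by (intro S.diff_closed S.sum_closed)
      ultimately have "p - (\<Sum>i<length FA. ?p i) \<in> ?I"
        by (auto simp: edge_ideal_eq nonface_ideal_def in_keys_iff)
      then show ?thesis unfolding sum p(2) by (simp add: Q.cls_eq_iff)
    qed
    ultimately show "\<exists>u. u \<in> (\<Pi>\<^sub>E i\<in>{..<length ?D}. stanley_space ?M (fst (?D ! i)) (snd (?D ! i))) \<and>
      x = (\<Oplus>\<^bsub>?M\<^esub>i\<in>{..<length ?D}. u i)" by blast
  next
    fix u u'
    assume u: "u \<in> (\<Pi>\<^sub>E i\<in>{..<length ?D}. stanley_space ?M (fst (?D ! i)) (snd (?D ! i))) \<and>
        x = (\<Oplus>\<^bsub>?M\<^esub>i\<in>{..<length ?D}. u i)"
      and u': "u' \<in> (\<Pi>\<^sub>E i\<in>{..<length ?D}. stanley_space ?M (fst (?D ! i)) (snd (?D ! i))) \<and>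
        x = (\<Oplus>\<^bsub>?M\<^esub>i\<in>{..<length ?D}. u' i)"
    have rep: "\<exists>p. (\<forall>i<length FA. p i \<in> polys ?V \<and> (\<forall>m\<in>Poly_Mapping.keys (p i). inb i m) \<and> u i = Q.cls (p i)) \<and>
        x = Q.cls (\<Sum>i<length FA. p i)"
      if u: "u \<in> (\<Pi>\<^sub>E i\<in>{..<length ?D}. stanley_space ?M (fst (?D ! i)) (snd (?D ! i))) \<and>
        x = (\<Oplus>\<^bsub>?M\<^esub>i\<in>{..<length ?D}. u i)" for u
    proof -
      have "\<exists>p. p \<in> polys ?V \<and> (\<forall>m\<in>Poly_Mapping.keys p. inb i m) \<and> u i = Q.cls p"
        if "i < length FA" for i
      proof -
        have "u i \<in> stanley_space ?M (fst (?D ! i)) (snd (?D ! i))"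
          using PiE_mem[OF conjunct1[OF u], of i] that by (simp del: nth_map)
        then show ?thesis unfolding space[OF that] by blast
      qed
      then obtain p where p: "\<And>i. i < length FA \<Longrightarrow>
          p i \<in> polys ?V \<and> (\<forall>m\<in>Poly_Mapping.keys (p i). inb i m) \<and> u i = Q.cls (p i)" by metis
      have "x = (\<Oplus>\<^bsub>?M\<^esub>i\<in>{..<length FA}. u i)" using u by simp
      also have "\<dots> = (\<Oplus>\<^bsub>?M\<^esub>i\<in>{..<length FA}. Q.cls (p i))"
        using p Q.cls_in_carrier by (intro Q.M.M.finsum_cong') auto
      also have "\<dots> = Q.cls (\<Sum>i<length FA. p i)" using p by (intro Q.finsum_cls) auto
      finally show ?thesis using p by blast
    qed
    obtain p where p: "\<And>i. i < length FA \<Longrightarrow> p i \<in> polys ?V \<and>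
        (\<forall>m\<in>Poly_Mapping.keys (p i). inb i m) \<and> u i = Q.cls (p i)" "x = Q.cls (\<Sum>i<length FA. p i)"
      using rep[OF u] by blast
    obtain p' where p': "\<And>i. i < length FA \<Longrightarrow> p' i \<in> polys ?V \<and>
        (\<forall>m\<in>Poly_Mapping.keys (p' i). inb i m) \<and> u' i = Q.cls (p' i)" "x = Q.cls (\<Sum>i<length FA. p' i)"
      using rep[OF u'] by blast
    have "(\<Sum>i<length FA. p i) - (\<Sum>i<length FA. p' i) \<in> ?I"
      using p(2) p'(2) Q.cls_eq_iff by metis
    then have I: "(\<Sum>i<length FA. p i - p' i) \<in> ?I" by (simp add: sum_subtractf)
    have "p i = p' i" if i: "i < length FA" for i
    proof (rule ccontr)
      assume "p i \<noteq> p' i"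
      then obtain m where m: "m \<in> Poly_Mapping.keys (p i - p' i)"
        by (metis ex_in_conv keys_eq_empty right_minus_eq)
      have inb: "inb j k" if "j < length FA" "k \<in> Poly_Mapping.keys (p j - p' j)" for j k
        using that keys_diff_subset[of "p j" "p' j"] p(1)[of j] p'(1)[of j] by blast
      have "Poly_Mapping.lookup (p j - p' j) m = 0" if "j < length FA" "j \<noteq> i" for j
        using unique[OF that(1) i _ inb[OF i m]] inb[OF that(1), of m] that by (auto simp: in_keys_iff)
      then have "Poly_Mapping.lookup (\<Sum>j<length FA. p j - p' j) m = Poly_Mapping.lookup (p i - p' i) m"
        using i unfolding lookup_sum by (subst sum.remove[of _ i]) auto
      then have "m \<in> Poly_Mapping.keys (\<Sum>j<length FA. p j - p' j)" using m by (simp add: in_keys_iff)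
      then have "\<not> indep (Poly_Mapping.keys m)" using I by (auto simp: edge_ideal_eq nonface_ideal_def)
      then show False using inb[OF i m] FAi[OF i] indep_mono unfolding inb_def by blast
    qed
    then have "u i = u' i" if "i < length FA" for i using p(1)[OF that] p'(1)[OF that] that by simp
    then show "u = u'" using u u' by (intro PiE_ext[of u "{..<length ?D}" _ u']) auto
  qed
  show ?thesis unfolding stanley_decomposition_def
  proof (intro conjI ballI)
    fix wA assume "wA \<in> set ?D"
    then show "case wA of (w, A) \<Rightarrow> w \<in> carrier ?M \<and> (\<exists>a. w \<in> quot_grading ?V ?I a) \<and> A \<subseteq> ?V \<and>
        free_module (mpoly_ring A :: ('v, 'k) mpoly ring) (?M\<lparr>carrier := stanley_space ?M w A\<rparr>)"
      using 1[of "fst wA" "snd wA"] by (simp only: case_prod_beta prod.collapse simp_thms)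
  qed (rule 2)
qed

text \<open>An independent set \<open>T\<close> lies in the interval that starts at \<open>T - A\<close>, and in no other.\<close>

lemma sdepth_ge:
  assumes A: "packing A"
  shows "enat (card A) \<le> sdepth (verts G) (quot_grading (verts G) (edge_ideal G))
    (quot_module S (edge_ideal G :: ('v, 'k::field) mpoly set))"
proof -
  let ?V = "verts G"
  define top where "top F = F \<union> {a \<in> A. nbhd a \<inter> F = {}}" for F
  have disj: "insert a (nbhd a) \<inter> insert b (nbhd b) = {}" if "a \<in> A" "b \<in> A" "a \<noteq> b" for a b
    using A that by (auto simp: packing_def)
  have AV: "A \<subseteq> ?V" using A by (simp add: packing_def)
  have "finite {F. F \<subseteq> ?V \<and> indep F \<and> F \<inter> A = {}}"
    by (rule finite_subset[of _ "Pow ?V"]) (auto simp: finite_verts)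
  from finite_distinct_list[OF this]
  obtain Fs where Fs: "set Fs = {F. F \<subseteq> ?V \<and> indep F \<and> F \<inter> A = {}}" "distinct Fs" by auto
  let ?FA = "map (\<lambda>F. (F, top F)) Fs"
  have top: "F \<subseteq> top F" "top F \<subseteq> ?V" "indep (top F)" if "F \<in> set Fs" for F
  proof -
    show "F \<subseteq> top F" "top F \<subseteq> ?V" using that AV by (auto simp: top_def Fs)
    have "v \<notin> nbhd u" if "u \<in> top F" "v \<in> top F" for u v
    proof -
      have "indep F" using \<open>F \<in> set Fs\<close> Fs by simp
      then show ?thesis
        using that disj[of u v] nbhd_sym[of u v] nbhd_irrefl[of u] unfolding top_def indep_def by blast
    qed
    then show "indep (top F)" unfolding indep_def by blast
  qed
  have "stanley_decomposition ?V (quot_grading ?V (edge_ideal G))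
      (quot_module S (edge_ideal G :: ('v, 'k) mpoly set))
      (map (\<lambda>(F, A). (Q.cls (Poly_Mapping.single (expo F) 1), A)) ?FA)" (is "stanley_decomposition _ _ ?M ?D")
  proof (rule stanley_decomposition_of_intervals)
    fix F T assume "(F, T) \<in> set ?FA"
    then show "F \<subseteq> T \<and> T \<subseteq> ?V \<and> indep T" using top by auto
  next
    fix T assume T: "T \<subseteq> ?V" "indep T"
    have iff: "F \<subseteq> T \<and> T \<subseteq> top F \<longleftrightarrow> F = T - A" if "F \<in> set Fs" for F
    proof
      assume "F \<subseteq> T \<and> T \<subseteq> top F"
      then show "F = T - A" using that Fs by (auto simp: top_def)
    next
      assume "F = T - A"
      then show "F \<subseteq> T \<and> T \<subseteq> top F" using T(2) by (auto simp: top_def indep_def)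
    qed
    have "T - A \<in> set Fs" using T indep_mono[of T "T - A"] by (auto simp: Fs)
    then obtain i where i: "i < length Fs" "Fs ! i = T - A" by (auto simp: in_set_conv_nth)
    show "\<exists>!i. i < length ?FA \<and> fst (?FA ! i) \<subseteq> T \<and> T \<subseteq> snd (?FA ! i)"
    proof (rule ex1I[of _ i])
      show "i < length ?FA \<and> fst (?FA ! i) \<subseteq> T \<and> T \<subseteq> snd (?FA ! i)"
        using i iff[of "Fs ! i"] \<open>T - A \<in> set Fs\<close> by simp
    next
      fix j assume "j < length ?FA \<and> fst (?FA ! j) \<subseteq> T \<and> T \<subseteq> snd (?FA ! j)"
      then have j: "j < length Fs" "Fs ! j = T - A" using iff[of "Fs ! j"] by auto
      then have "Fs ! j = Fs ! i" using i by metis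
      then show "j = i" using nth_eq_iff_index_eq[OF Fs(2) j(1) i(1)] by blast
    qed
  qed
  moreover have "enat (card A) \<le> (INF (w, T) \<in> set ?D. enat (card T))"
  proof (rule INF_greatest)
    fix wT assume "wT \<in> set ?D"
    then obtain F where F: "F \<in> set Fs" "snd wT = top F" by auto
    \<comment> \<open>Injective because \<open>g a\<close> lies in the closed neighbourhood of \<open>a\<close>.\<close>
    define g where "g a = (if nbhd a \<inter> F = {} then a else (SOME v. v \<in> nbhd a \<inter> F))" for a
    have g: "g a \<in> insert a (nbhd a) \<inter> top F" if "a \<in> A" for a
    proof (cases "nbhd a \<inter> F = {}")
      case False
      then have "(SOME v. v \<in> nbhd a \<inter> F) \<in> nbhd a \<inter> F"
        using some_in_eq[of "nbhd a \<inter> F"] by simp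
      then show ?thesis using False by (auto simp: g_def top_def)
    qed (use that in \<open>auto simp: g_def top_def\<close>)
    have "inj_on g A"
    proof (rule inj_onI, rule ccontr)
      fix a b assume ab: "a \<in> A" "b \<in> A" "g a = g b" "a \<noteq> b"
      have "g a \<in> insert a (nbhd a)" using g[OF ab(1)] by blast
      moreover have "g a \<in> insert b (nbhd b)" unfolding ab(3) using g[OF ab(2)] by blast
      ultimately show False using disj[OF ab(1,2,4)] by blast
    qed
    moreover have "g ` A \<subseteq> top F" using g by blast
    moreover have "finite (top F)" using top(2)[OF F(1)] finite_verts by (rule finite_subset)
    ultimately have "card A \<le> card (top F)" by (rule card_inj_on_le)
    then show "enat (card A) \<le> (case wT of (w, T) \<Rightarrow> enat (card T))" using F by (simp add: case_prod_beta)
  qed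
  ultimately show ?thesis unfolding sdepth_def by (intro SUP_upper2[of ?D]) auto
qed

text \<open>In each multidegree the quotient has dimension at most one, so some Stanley space \<open>w K[A]\<close> contributes
  to the multidegree of \<open>x\<^sup>D\<close>: \<open>x\<^sup>D\<close> is a scalar multiple of \<open>\<nu> w\<close> with a monomial \<open>\<nu>\<close> in \<open>A\<close>. If
  \<open>A\<close> contained some \<open>v \<notin> D\<close>, then \<open>\<nu> v\<close> would kill \<open>w\<close>, as \<open>v\<close> has a neighbour in \<open>D\<close>, and \<open>w\<close>
  would be zero by freeness.\<close>

lemma sdepth_le:
  assumes D: "dominating D" "indep D"
  shows "sdepth (verts G) (quot_grading (verts G) (edge_ideal G))
    (quot_module S (edge_ideal G :: ('v, 'k::field) mpoly set)) \<le> enat (card D)"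
  unfolding sdepth_def
proof (rule SUP_least)
  let ?V = "verts G" and ?I = "edge_ideal G :: ('v, 'k) mpoly set"
  let ?M = "quot_module S ?I"
  fix L assume "L \<in> {L. stanley_decomposition ?V (quot_grading ?V ?I) ?M L}"
  then have dec: "stanley_decomposition ?V (quot_grading ?V ?I) ?M L" by simp
  have L1: "(\<exists>a. w \<in> quot_grading ?V ?I a) \<and> A \<subseteq> ?V \<and>
        free_module (mpoly_ring A :: ('v, 'k) mpoly ring) (?M\<lparr>carrier := stanley_space ?M w A\<rparr>)"
    if "(w, A) \<in> set L" for w A
    using bspec[OF conjunct1[OF dec[unfolded stanley_decomposition_def]] that] by simp
  have L2: "\<exists>u. u \<in> (\<Pi>\<^sub>E i\<in>{..<length L}. stanley_space ?M (fst (L ! i)) (snd (L ! i))) \<and>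
        x = (\<Oplus>\<^bsub>?M\<^esub>i\<in>{..<length L}. u i)" if "x \<in> carrier ?M" for x
    by (rule ex1_implies_ex)
      (rule bspec[OF conjunct2[OF dec[unfolded stanley_decomposition_def]] that])
  have DV: "D \<subseteq> ?V" "finite D"
    using D finite_subset[OF _ finite_verts] by (auto simp: dominating_def)
  let ?x = "Poly_Mapping.single (expo D) 1 :: ('v, 'k) mpoly"
  have x: "?x \<in> polys ?V" using DV by (simp add: single_in_polys keys_expo)
  have hom: "\<exists>\<mu> c. Poly_Mapping.keys \<mu> \<subseteq> ?V \<and> fst (L ! i) = Q.cls (Poly_Mapping.single \<mu> c)"
    if i: "i < length L" for i
  proof -
    obtain a p where p: "p \<in> polys ?V" "\<And>m v. m \<in> Poly_Mapping.keys p \<Longrightarrow> int (Poly_Mapping.lookup m v) = a v"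
        "fst (L ! i) = Q.cls p"
      using L1[of "fst (L ! i)" "snd (L ! i)"] i
      by (auto simp: quot_grading_def mpoly_grading_def Q.cls_def)
    show ?thesis
    proof (cases "p = 0")
      case True
      then show ?thesis using p(3) by (intro exI[of _ 0]) simp
    next
      case False
      then obtain m where m: "m \<in> Poly_Mapping.keys p" by (metis keys_eq_empty ex_in_conv)
      have "k = m" if "k \<in> Poly_Mapping.keys p" for k
        using p(2)[OF m] p(2)[OF that] by (intro poly_mapping_eqI) (metis of_nat_eq_iff)
      then have "Poly_Mapping.keys p = {m}" using m by blast
      then have "p = Poly_Mapping.single m (Poly_Mapping.lookup p m)"
        using mpoly_expand[of p] by simp
      then have "fst (L ! i) = Q.cls (Poly_Mapping.single m (Poly_Mapping.lookup p m))"
        using p(3) by metis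
      then show ?thesis using p(1) m unfolding polys_def by blast
    qed
  qed
  obtain \<mu> c where mc: "\<And>i. i < length L \<Longrightarrow>
      Poly_Mapping.keys (\<mu> i) \<subseteq> ?V \<and> fst (L ! i) = Q.cls (Poly_Mapping.single (\<mu> i) (c i))"
    using hom by metis
  let ?w = "\<lambda>i. Poly_Mapping.single (\<mu> i) (c i)"
  have w: "?w i \<in> polys ?V" if "i < length L" for i using mc[OF that] by (simp add: single_in_polys)
  have AV: "snd (L ! i) \<subseteq> ?V" if "i < length L" for i
    using L1[of "fst (L ! i)" "snd (L ! i)"] that by simp
  obtain u where u: "u \<in> (\<Pi>\<^sub>E i\<in>{..<length L}. stanley_space ?M (fst (L ! i)) (snd (L ! i)))"
      "Q.cls ?x = (\<Oplus>\<^bsub>?M\<^esub>i\<in>{..<length L}. u i)"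
    using L2[OF Q.cls_in_carrier[OF x]] by blast
  have "\<exists>q. q \<in> polys (snd (L ! i)) \<and> u i = Q.cls (q * ?w i)" if "i < length L" for i
  proof -
    have "u i \<in> stanley_space ?M (fst (L ! i)) (snd (L ! i))" using u(1) that by (auto dest: PiE_mem)
    then show ?thesis using mc[OF that] Q.stanley_space_cls[OF AV[OF that] w[OF that]] by auto
  qed
  then obtain q where q: "\<And>i. i < length L \<Longrightarrow> q i \<in> polys (snd (L ! i)) \<and> u i = Q.cls (q i * ?w i)"
    by metis
  have qV: "q i * ?w i \<in> polys ?V" if "i < length L" for i
    using polys_mono[OF AV[OF that]] q[OF that] w[OF that] by (intro S.mult_closed) auto
  have "Q.cls ?x = (\<Oplus>\<^bsub>?M\<^esub>i\<in>{..<length L}. Q.cls (q i * ?w i))"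
    unfolding u(2) using q qV Q.cls_in_carrier by (intro Q.M.M.finsum_cong') auto
  also have "\<dots> = Q.cls (\<Sum>i<length L. q i * ?w i)" using qV by (intro Q.finsum_cls) auto
  finally have xI: "?x - (\<Sum>i<length L. q i * ?w i) \<in> ?I" by (simp add: Q.cls_eq_iff)
  have not_I: "Poly_Mapping.lookup p (expo D) = 0" if "p \<in> ?I" for p
  proof (rule ccontr)
    assume "Poly_Mapping.lookup p (expo D) \<noteq> 0"
    then have "expo D \<in> Poly_Mapping.keys p" by (simp add: in_keys_iff)
    then show False using that D(2) DV(2) by (auto simp: edge_ideal_eq nonface_ideal_def keys_expo)
  qed
  have "(\<Sum>i<length L. Poly_Mapping.lookup (q i * ?w i) (expo D)) = 1"
    using not_I[OF xI] by (simp add: lookup_minus lookup_sum)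
  then obtain i where i: "i < length L" "Poly_Mapping.lookup (q i * ?w i) (expo D) \<noteq> 0"
    by (metis (no_types, lifting) lessThan_iff sum.neutral zero_neq_one)
  then have "expo D \<in> Poly_Mapping.keys (q i * ?w i)" by (simp add: in_keys_iff)
  then obtain \<nu> where \<nu>: "\<nu> \<in> Poly_Mapping.keys (q i)" "expo D = \<nu> + \<mu> i"
    using subsetD[OF Poly_Mapping.keys_mult] by (fastforce split: if_splits)
  have "?w i \<notin> ?I"
  proof
    assume "?w i \<in> ?I"
    then have "q i * ?w i \<in> ?I"
      using polys_mono[OF AV[OF i(1)]] q[OF i(1)] S.ideal_mult[OF is_ideal_edge_ideal] by blast
    then show False using not_I i(2) by blast
  qed
  have "snd (L ! i) \<subseteq> D"
  proof
    fix v assume v: "v \<in> snd (L ! i)"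
    show "v \<in> D"
    proof (rule ccontr)
      assume "v \<notin> D"
      then have "nbhd v \<inter> D \<noteq> {}" using D(1) v AV[OF i(1)] unfolding dominating_def by blast
      then obtain d where d: "d \<in> D" "d \<in> nbhd v" by blast
      let ?m = "\<nu> + Poly_Mapping.single v 1"
      have m: "Poly_Mapping.keys ?m \<subseteq> snd (L ! i)"
        using v \<nu>(1) q[OF i(1)] by (auto simp: keys_monom_add polys_def)
      have sum: "?m + \<mu> i = expo D + Poly_Mapping.single v 1" unfolding \<nu>(2) by (simp add: add_ac)
      have "Poly_Mapping.keys (?m + \<mu> i) = insert v D"
        unfolding sum using DV by (simp add: keys_monom_add keys_expo)
      then have "Poly_Mapping.single ?m 1 * ?w i \<in> ?I"
        using d v AV[OF i(1)] DV
        by (auto simp: mult_single edge_ideal_eq nonface_ideal_def polys_def indep_insert)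
      moreover have "(fst (L ! i), snd (L ! i)) \<in> set L" using i(1) by simp
      then have "free_module (mpoly_ring (snd (L ! i)) :: ('v, 'k) mpoly ring)
          (?M\<lparr>carrier := stanley_space ?M (Q.cls (?w i)) (snd (L ! i))\<rparr>)"
        using conjunct2[OF conjunct2[OF L1]] conjunct2[OF mc[OF i(1)]] by metis
      ultimately have "?w i \<in> ?I"
        using Q.monomial_smult_eq_0[OF AV[OF i(1)] w[OF i(1)] _ m] by blast
      then show False using \<open>?w i \<notin> ?I\<close> by blast
    qed
  qed
  then have "card (snd (L ! i)) \<le> card D" using DV by (intro card_mono) auto
  then show "(INF (w, A) \<in> set L. enat (card A)) \<le> enat (card D)"
    using i(1) by (intro INF_lower2[of "L ! i"]) (auto simp: case_prod_beta)
qed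

end

section \<open>The strong product of a path with the path on three vertices\<close>

lemma strong_grid_nbhd:
  assumes "fin_graph (strong_grid n m)"
  shows "(k, l) \<in> fin_graph.nbhd (strong_grid n m) (i, j) \<longleftrightarrow>
    (i, j) \<in> {1..n} \<times> {1..m} \<and> (k, l) \<in> {1..n} \<times> {1..m} \<and> (i, j) \<noteq> (k, l) \<and>
    \<bar>int i - int k\<bar> \<le> 1 \<and> \<bar>int j - int l\<bar> \<le> 1"
  unfolding fin_graph.nbhd_def[OF assms] by (auto simp: strong_grid_edge_iff)

theorem lemma3p3:
  fixes n :: nat
    and V :: "(nat \<times> nat) set"
    and S :: "(nat \<times> nat, 'k::field) mpoly ring"
    and I :: "(nat \<times> nat, 'k) mpoly set"
  assumes "n \<ge> 1"
    and "V = {1..n} \<times> {1..3}"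
    and "S = mpoly_ring V"
    and "I = edge_ideal (strong_grid n 3)"
  shows "depth S (irrelevant_ideal V) (quot_module S I) = enat (nat \<lceil>real n / 3\<rceil>) \<and>
    sdepth V (quot_grading V I) (quot_module S I) = enat (nat \<lceil>real n / 3\<rceil>)"
proof -
  let ?G = "strong_grid n 3"
  interpret G: fin_graph ?G
  proof
    show "finite (verts ?G)" by (simp add: verts_strong_grid)
    show "u \<in> verts ?G \<and> u \<noteq> v" if "{u, v} \<in> edges ?G" for u v
      using that by (cases u; cases v) (auto simp: strong_grid_edge_iff verts_strong_grid)
  qed
  note nbhd = strong_grid_nbhd[OF G.fin_graph_axioms]
  define k where "k = (n + 2) div 3"
  have k: "nat \<lceil>real n / 3\<rceil> = k"
  proof -
    have "n \<le> 3 * k" "3 * k < n + 3" unfolding k_def by linarith+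
    then have "\<lceil>real n / 3\<rceil> = int k" by (intro ceiling_unique) auto
    then show ?thesis by simp
  qed
  have V: "V = verts ?G" using assms(2) by (simp add: verts_strong_grid)
  \<comment> \<open>Rows are numbered from 1, the blocks of three rows from 0.\<close>
  define A where "A = (\<lambda>j. (3 * j + 1, 2::nat)) ` {..<k}"
  define D where "D = (\<lambda>j. (min (3 * j + 2) n, 2::nat)) ` {..<k}"
  have A: "G.packing A" "card A = k"
  proof -
    show "card A = k" unfolding A_def by (subst card_image) (auto simp: inj_on_def)
    have "False" if "x \<in> insert (3 * i + 1, 2) (G.nbhd (3 * i + 1, 2))"
        "x \<in> insert (3 * j + 1, 2) (G.nbhd (3 * j + 1, 2))" "i \<noteq> j" for x i j
      using that by (cases x) (auto simp: nbhd)
    moreover have "A \<subseteq> verts ?G" by (auto simp: A_def verts_strong_grid k_def)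
    ultimately show "G.packing A" unfolding G.packing_def A_def by blast
  qed
  have D: "G.dominating D" "G.indep D" "card D \<le> k"
  proof -
    show "card D \<le> k" unfolding D_def using card_image_le[of "{..<k}"] by fastforce
    have "\<exists>d\<in>D. d \<in> G.nbhd (i, j)" if "(i, j) \<in> verts ?G - D" for i j
    proof -
      let ?b = "(i - 1) div 3"
      have "?b < k" using that by (auto simp: k_def verts_strong_grid)
      then have "(min (3 * ?b + 2) n, 2) \<in> D" by (auto simp: D_def)
      moreover from this have "(min (3 * ?b + 2) n, 2) \<in> G.nbhd (i, j)"
        using that \<open>?b < k\<close> by (auto simp: nbhd verts_strong_grid)
      ultimately show ?thesis by blast
    qed
    moreover have "D \<subseteq> verts ?G" using \<open>n \<ge> 1\<close> by (auto simp: D_def verts_strong_grid)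
    ultimately show "G.dominating D" unfolding G.dominating_def by fast
    \<comment> \<open>The last block has at least one row, so cutting off at \<open>n\<close> shortens a distance of 3 by at most 1.\<close>
    have far: "min (3 * i + 2) n + 2 \<le> min (3 * j + 2) n" if "i < j" "j < k" for i j
    proof -
      have "3 * k \<le> n + 2" unfolding k_def by linarith
      then show ?thesis using that by auto
    qed
    have "(min (3 * j + 2) n, 2) \<notin> G.nbhd (min (3 * i + 2) n, 2)" if "i < k" "j < k" for i j
      using that far[of i j] far[of j i] by (cases i j rule: linorder_cases) (auto simp: nbhd)
    then show "G.indep D" unfolding G.indep_def D_def by blast
  qed
  show ?thesis
    unfolding assms(3,4) V k
    using G.depth_ge[OF A(1), where 'k = 'k] G.sdepth_ge[OF A(1), where 'k = 'k]
      G.depth_le[OF D(1,2), where 'k = 'k] G.sdepth_le[OF D(1,2), where 'k = 'k] A(2) D(3)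
    by (auto intro!: antisym elim: order_trans)
qed

end
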